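(* Let $G=(V,E)$ be a graph on $n$ vertices with average degree $\bar{d}$, let $K$ be a constant positive integer, and let $G'=(V,E')$ be the port-labelled multigraph described in the context. For a vertex $v$ chosen uniformly at random from $V$ and a permutation $\pi$ chosen uniformly at random over $E'$, $$\mathbb{E}_{v,\pi}[T(v,\pi)]=O(\bar{d}\cdot\log^2 n).$$
   Context: Each vertex $w$ has two ports $w^0,w^1$. The multigraph $G'$ has, for each edge $(u,v)\in E$, $K+2$ parallel copies: one copy that occupies ports $u^0$ and $v^1$, one that occupies $u^1$ and $v^0$, and $K$ copies that each occupy $u^0$ and $v^0$. Two edges $e,e'\in E'$ sharing an endpoint $w$ form a conflicting pair if both occupy the same port $w^i$ ($i\in\{0,1\}$). Given a permutation (ranking) $\pi$ of $E'$, define two recursive procedures. The edge oracle $\mathrm{EO}(e,u,\pi)$ (where $u$ is an endpoint of $e$): if $\mathrm{EO}(e,u,\pi)$ has been computed before, return the stored result; otherwise, let $e_1,\dots,e_r$ be the edges of $E'$ that form a conflicting pair with $e$ and satisfy $\pi(e_1)<\dots<\pi(e_r)<\pi(e)$, with $v_i$ the endpoint of $e_i$ not shared with $e$; for $i=1,\dots,r$, if $\mathrm{EO}(e_i,v_i,\pi)$ returns true then return false; finally return true. The vertex oracle $\mathrm{VO}(u,\pi)$: let $e_1=(u,v_1),\dots,e_r=(u,v_r)$ be the edges of $E'$ incident to $u$ with $\pi(e_1)<\dots<\pi(e_r)$; set $d\gets 0$; for $i=1,\dots,r$, if $\mathrm{EO}(e_i,v_i,\pi)$ returns true then $d\gets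 d+1$; return $d$. $T(v,\pi)$ denotes the number of (recursive) calls to the edge oracle during the execution of $\mathrm{VO}(v,\pi)$. *)

theory Defs
  imports Complex_Main "HOL-Combinatorics.Multiset_Permutations"
begin

definition simple_graph :: "nat set \<Rightarrow> nat set set \<Rightarrow> bool" where
  "simple_graph V E \<longleftrightarrow> finite V \<and> (\<forall>e\<in>E. e \<subseteq> V \<and> card e = 2)"

definition avg_deg :: "nat set \<Rightarrow> nat set set \<Rightarrow> real" where
  "avg_deg V E = 2 * real (card E) / real (card V)"

text \<open>An edge of the multigraph G' is represented by the set of the two ports it occupies
(a port w^i is the pair (w,i)) together with a copy index distinguishing parallel copies.\<close>

type_synonym pedge = "(nat \<times> nat) set \<times> nat"

definition Gprime :: "nat \<Rightarrow> nat set set \<Rightarrow> pedge set" where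
  "Gprime K E =
     {({(u,0),(v,1)}, 0) | u v. {u,v} \<in> E} \<union>
     {({(u,0),(v,0)}, c) | u v c. {u,v} \<in> E \<and> c < K}"

definition ports :: "pedge \<Rightarrow> (nat \<times> nat) set" where
  "ports e = fst e"

definition endpoints :: "pedge \<Rightarrow> nat set" where
  "endpoints e = fst ` ports e"

definition conflicting :: "pedge \<Rightarrow> pedge \<Rightarrow> bool" where
  "conflicting e e' \<longleftrightarrow> e \<noteq> e' \<and> (\<exists>w i. (w,i) \<in> ports e \<and> (w,i) \<in> ports e')"

text \<open>A ranking pi of E' is a list enumerating E' without repetition; pi(e) < pi(e')
iff e occurs before e' in the list.\<close>

definition lower_conflicts :: "pedge list \<Rightarrow> pedge \<Rightarrow> pedge list" where
  "lower_conflicts \<pi> e = filter (conflicting e) (takeWhile (\<lambda>x. x \<noteq> e) \<pi>)"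

primrec run_list :: "('e \<Rightarrow> 's \<Rightarrow> bool \<times> 's) \<Rightarrow> 'e list \<Rightarrow> 's \<Rightarrow> bool \<times> 's" where
  "run_list g [] s = (True, s)"
| "run_list g (x # xs) s =
     (case g x s of (b, s') \<Rightarrow> if b then (False, s') else run_list g xs s')"

text \<open>Oracle state: memo table for EO(e,u) and the number of EO calls made so far.\<close>

type_synonym ostate = "((pedge \<times> nat) \<Rightarrow> bool option) \<times> nat"

text \<open>Edge oracle with a fuel parameter (recursion depth bound, always sufficient when
fuel exceeds |E'|, since ranks strictly decrease). Every call (including calls answered
from the memo table) increments the call counter. sel e x is the endpoint v_i of the
conflicting edge x passed on in the recursive call from e.\<close>

primrec EO :: "nat \<Rightarrow> (pedge \<Rightarrow> pedge \<Rightarrow> nat) \<Rightarrow> pedge list \<Rightarrow> pedge \<Rightarrow> nat \<Rightarrow> ostate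
               \<Rightarrow> bool \<times> ostate" where
  "EO 0 sel \<pi> e u s = (False, s)"
| "EO (Suc f) sel \<pi> e u s =
     (case s of (memo, cnt) \<Rightarrow>
       (case memo (e, u) of
          Some b \<Rightarrow> (b, (memo, Suc cnt))
        | None \<Rightarrow>
            (case run_list (\<lambda>x. EO f sel \<pi> x (sel e x)) (lower_conflicts \<pi> e) (memo, Suc cnt) of
               (b, (m2, c2)) \<Rightarrow> (b, (m2((e, u) := Some b), c2)))))"

definition other_end :: "nat \<Rightarrow> pedge \<Rightarrow> nat" where
  "other_end u e = (THE w. w \<in> endpoints e \<and> w \<noteq> u)"

definition VO :: "(pedge \<Rightarrow> pedge \<Rightarrow> nat) \<Rightarrow> pedge list \<Rightarrow> nat \<Rightarrow> nat \<times> ostate" where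
  "VO sel \<pi> u =
     fold (\<lambda>x (d, s). case EO (Suc (length \<pi>)) sel \<pi> x (other_end u x) s of
                         (b, s') \<Rightarrow> (if b then Suc d else d, s'))
          (filter (\<lambda>x. u \<in> endpoints x) \<pi>) (0, (\<lambda>_. None, 0))"

definition T :: "(pedge \<Rightarrow> pedge \<Rightarrow> nat) \<Rightarrow> nat \<Rightarrow> pedge list \<Rightarrow> nat" where
  "T sel v \<pi> = snd (snd (VO sel \<pi> v))"

definition valid_sel :: "pedge set \<Rightarrow> (pedge \<Rightarrow> pedge \<Rightarrow> nat) \<Rightarrow> bool" where
  "valid_sel E' sel \<longleftrightarrow> (\<forall>e\<in>E'. \<forall>x\<in>E'. conflicting e x \<longrightarrow>
      sel e x \<in> endpoints x \<and> (endpoints x - endpoints e \<noteq> {} \<longrightarrow> sel e x \<notin> endpoints e))"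

definition expected_T :: "nat \<Rightarrow> nat set \<Rightarrow> nat set set \<Rightarrow> (pedge \<Rightarrow> pedge \<Rightarrow> nat) \<Rightarrow> real" where
  "expected_T K V E sel =
     (\<Sum>v\<in>V. \<Sum>\<pi>\<in>permutations_of_set (Gprime K E). real (T sel v \<pi>))
     / (real (card V) * real (card (permutations_of_set (Gprime K E))))"

end

theory Submission
  imports Defs
begin

text \<open>An edge is reported true iff it belongs to the greedy matching on ports, and by memoisation every
edge is evaluated at most twice. Hence, up to constants, the total number of calls is the number
of triples \<open>(f, e, x)\<close> where \<open>e\<close> is reachable from \<open>f\<close> by queries and \<open>x\<close> is queried by \<open>e\<close>.

If \<open>e \<noteq> f\<close>, there is a walk \<open>f, f\<^sub>1, \<dots>, f\<^sub>k = e\<close> of queries. Rotate the ranks along \<open>f\<^sub>1, \<dots>, f\<^sub>k\<close>, so that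
\<open>e\<close> receives the rank \<open>s\<close> of \<open>f\<^sub>1\<close>. The rotated ranking and the port at which \<open>e\<close> was entered
determine the original ranking and the port shared by \<open>f\<close> and \<open>f\<^sub>1\<close>; moreover \<open>e\<close> still queries \<open>x\<close>,
and an exchange argument shows that the edge at position \<open>s\<close> queries at most two edges on average.
The edge \<open>f\<close> survives the first \<open>s\<close> steps of the greedy matching, and with high probability no port
keeps more than \<open>O(|E'| log n / s)\<close> surviving edges. Summing over \<open>s\<close> yields \<open>O(|E'| log\<^sup>2 n)\<close>.\<close>

subsection \<open>Greedy matching and rotations along query walks\<close>

lemma conflicting_iff: "conflicting e e' \<longleftrightarrow> e \<noteq> e' \<and> (\<exists>p. p \<in> ports e \<and> p \<in> ports e')"
  by (auto simp: conflicting_def)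

text \<open>The members of this matching, taken in rank order, turn out to be exactly the edges on
  which the oracle returns true.\<close>

definition greedy :: "pedge list \<Rightarrow> pedge set" where
  "greedy xs = fold (\<lambda>e A. if \<exists>y\<in>A. conflicting e y then A else insert e A) xs {}"

text \<open>As \<open>conflicting\<close> is irreflexive, an edge already matched in
  \<open>us\<close> also counts as free; hence the separate non-membership conditions below.\<close>

definition free :: "pedge list \<Rightarrow> pedge \<Rightarrow> bool" where
  "free us e \<longleftrightarrow> (\<forall>y\<in>greedy us. \<not> conflicting e y)"

definition port_free :: "pedge list \<Rightarrow> nat \<times> nat \<Rightarrow> bool" where
  "port_free us p \<longleftrightarrow> (\<forall>y\<in>greedy us. p \<notin> ports y)"

lemma greedy_Nil [simp]: "greedy [] = {}"
  by (simp add: greedy_def)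

lemma greedy_snoc: "greedy (us @ [e]) = (if free us e then insert e (greedy us) else greedy us)"
  by (simp add: greedy_def free_def)

lemma greedy_mono: "greedy us \<subseteq> greedy (us @ vs)"
proof (induction vs rule: rev_induct)
  case (snoc e vs)
  then show ?case
    using greedy_snoc[of "us @ vs" e] by auto
qed simp

lemma greedy_append_subset: "greedy (us @ vs) \<subseteq> greedy us \<union> set vs"
proof (induction vs rule: rev_induct)
  case (snoc e vs)
  then show ?case
    using greedy_snoc[of "us @ vs" e] by auto
qed simp

lemma greedy_subset_set: "greedy us \<subseteq> set us"
  using greedy_append_subset[of "[]" us] by simp

lemma greedy_take_mono: "i \<le> j \<Longrightarrow> greedy (take i us) \<subseteq> greedy (take j us)"
  using greedy_mono[of "take i us" "drop i (take j us)"]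
  by (metis append_take_drop_id min.absorb1 take_take)

lemma greedy_indep: "e \<in> greedy us \<Longrightarrow> y \<in> greedy us \<Longrightarrow> \<not> conflicting e y"
proof (induction us rule: rev_induct)
  case (snoc x us)
  then show ?case
    by (auto simp: greedy_snoc free_def conflicting_iff split: if_splits)
qed simp

lemma greedy_port_unique:
  "e \<in> greedy us \<Longrightarrow> y \<in> greedy us \<Longrightarrow> p \<in> ports e \<Longrightarrow> p \<in> ports y \<Longrightarrow> e = y"
  using greedy_indep conflicting_iff by blast

lemma free_take_antimono: "i \<le> j \<Longrightarrow> free (take j us) e \<Longrightarrow> free (take i us) e"
  using greedy_take_mono unfolding free_def by blast

text \<open>Greedy decides an edge when it reaches it; later edges cannot remove it, and
  distinctness prevents a second chance.\<close>

lemma nth_mem_greedy_iff: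
  assumes "distinct us" "i < length us"
  shows "us ! i \<in> greedy us \<longleftrightarrow> free (take i us) (us ! i)"
proof -
  have us: "us = take (Suc i) us @ drop (Suc i) us" by simp
  have tk: "take (Suc i) us = take i us @ [us ! i]"
    using assms(2) by (simp add: take_Suc_conv_app_nth)
  have nd: "us ! i \<notin> set (drop (Suc i) us)"
    using assms by (metis id_take_nth_drop distinct_append distinct.simps(2))
  have "us ! i \<in> greedy us \<longleftrightarrow> us ! i \<in> greedy (take (Suc i) us)"
    using greedy_append_subset[of "take (Suc i) us" "drop (Suc i) us"]
      greedy_mono[of "take (Suc i) us" "drop (Suc i) us"] nd by auto
  also have "\<dots> \<longleftrightarrow> free (take i us) (us ! i)"
  proof -
    have "us ! i \<notin> set (take i us)"
      using assms by (metis id_take_nth_drop distinct_append disjoint_iff list.set_intros(1))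
    then have "us ! i \<notin> greedy (take i us)"
      using greedy_subset_set by blast
    then show ?thesis
      unfolding tk greedy_snoc by auto
  qed
  finally show ?thesis .
qed

lemma free_port_free:
  assumes "free us e" "e \<notin> set us" "p \<in> ports e"
  shows "port_free us p"
  unfolding port_free_def
proof (intro ballI notI)
  fix y assume y: "y \<in> greedy us" "p \<in> ports y"
  then have "y \<noteq> e" using assms(2) greedy_subset_set by blast
  then have "conflicting e y" using y(2) assms(3) unfolding conflicting_iff by metis
  then show False using y(1) assms(1) unfolding free_def by simp
qed

text \<open>The edges queried during the evaluation of \<open>e\<close>: all lower edges in conflict with \<open>e\<close>, up to and
including the first matched one.\<close>

definition child :: "pedge list \<Rightarrow> pedge \<Rightarrow> pedge \<Rightarrow> bool" where
  "child \<pi> e x \<longleftrightarrow> (\<exists>j k. j < k \<and> k < length \<pi> \<and> \<pi> ! j = x \<and> \<pi> ! k = e \<and>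
     conflicting e x \<and> free (take j \<pi>) e)"

definition children :: "pedge list \<Rightarrow> pedge \<Rightarrow> pedge set" where
  "children \<pi> e = {x. child \<pi> e x}"

lemma child_in_set: "child \<pi> e x \<Longrightarrow> x \<in> set \<pi> \<and> e \<in> set \<pi>"
  unfolding child_def by (metis nth_mem order_less_trans)

lemma children_subset: "children \<pi> e \<subseteq> set \<pi>"
  using child_in_set unfolding children_def by blast

lemma finite_children [simp]: "finite (children \<pi> e)"
  using children_subset finite_subset by blast

text \<open>\<open>x\<close> precedes \<open>e\<close>, and \<open>d\<close>, being free up to
  \<open>e\<close>, is free up to \<open>x\<close> as well; the common port supplies the conflict.
  This is what shortens a walk that turns back.\<close>

lemma child_trans:
  assumes "distinct \<pi>" "child \<pi> d e" "child \<pi> e x" "p \<in> ports d" "p \<in> ports x"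
  shows "child \<pi> d x"
proof -
  obtain i k where ik: "i < k" "k < length \<pi>" "\<pi> ! i = e" "\<pi> ! k = d" "free (take i \<pi>) d"
    using assms(2) unfolding child_def by blast
  obtain j i' where ji: "j < i'" "i' < length \<pi>" "\<pi> ! j = x" "\<pi> ! i' = e"
    using assms(3) unfolding child_def by blast
  have "i' = i"
    using assms(1) ik ji by (metis nth_eq_iff_index_eq order_less_trans)
  then have jk: "j < i" using ji by simp
  then have "d \<noteq> x"
    using assms(1) ik ji by (metis nth_eq_iff_index_eq order_less_trans order_less_irrefl)
  then have "conflicting d x"
    using assms(4,5) conflicting_iff by blast
  then show ?thesis
    unfolding child_def using ik ji jk free_take_antimono[of j i] by (metis order_less_imp_le order_less_trans)
qed

text \<open>Here \<open>f\<^sub>1, \<dots>, f\<^sub>k = e\<close> is a walk of successive queries in \<open>\<pi>\<close>, where \<open>f\<^sub>1\<close> has position \<open>s\<close> and is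
entered at \<open>p\<close>, every edge is left through the port at which it was not entered, and \<open>e\<close> is entered at
\<open>q\<close>. The ranking \<open>\<sigma>\<close> moves \<open>e\<close> to position \<open>s\<close> and each other \<open>f\<^sub>i\<close> to the place of \<open>f\<^sub>i\<^sub>+\<^sub>1\<close>. That \<open>p\<close> is
unmatched before \<open>s\<close> is what makes the length of the walk recoverable from \<open>\<sigma>\<close>.\<close>

inductive rot :: "pedge list \<Rightarrow> nat \<Rightarrow> nat \<times> nat \<Rightarrow> pedge \<Rightarrow> nat \<times> nat \<Rightarrow> pedge list \<Rightarrow> bool"
  for \<pi> s p where
  start: "s < length \<pi> \<Longrightarrow> p \<in> ports (\<pi> ! s) \<Longrightarrow> port_free (take s \<pi>) p \<Longrightarrow> rot \<pi> s p (\<pi> ! s) p \<pi>"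
| step: "rot \<pi> s p e q \<sigma> \<Longrightarrow> child \<pi> e x \<Longrightarrow> r \<in> ports e \<Longrightarrow> r \<noteq> q \<Longrightarrow> r \<in> ports x \<Longrightarrow>
    rot \<pi> s p x r (map (transpose e x) \<sigma>)"

text \<open>For \<open>us = take s \<pi>\<close> this contains every edge at \<open>p\<close> that
  queries \<open>\<pi> ! s\<close>, so its size bounds the choices for the origin \<open>f\<close>
  of a walk.\<close>

definition alive :: "pedge set \<Rightarrow> pedge list \<Rightarrow> nat \<times> nat \<Rightarrow> pedge set" where
  "alive F us p = {f\<in>F. f \<notin> set us \<and> p \<in> ports f \<and> free us f}"

lemma map_transpose_perm:
  assumes "\<sigma> \<in> permutations_of_set F" "e \<in> F" "x \<in> F"
  shows "map (transpose e x) \<sigma> \<in> permutations_of_set F"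
proof -
  have "transpose e x ` F = F"
    using assms(2,3) by (simp add: transpose_image_eq)
  moreover have "inj_on (transpose e x) F" by simp
  ultimately show ?thesis
    using assms(1) unfolding permutations_of_set_def by (auto simp: distinct_map)
qed

lemma map_transpose_id:
  assumes "e \<notin> set us" "x \<notin> set us"
  shows "map (transpose e x) us = us"
  using assms by (intro map_idI) (metis transpose_apply_other)

lemma inj_map_transpose: "map (transpose a b) us = map (transpose a b) vs \<Longrightarrow> us = vs"
  using inj_map_eq_map[OF inj_on_transpose, of a b us vs] by simp

lemma nth_notin_take: "distinct us \<Longrightarrow> j \<le> i \<Longrightarrow> i < length us \<Longrightarrow> us ! i \<notin> set (take j us)"
  by (auto simp: in_set_conv_nth nth_eq_iff_index_eq)

section \<open>Invariants and reversibility of rotations\<close>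

locale port_multigraph =
  fixes F :: "pedge set"
  assumes finite_F: "finite F"
    and card_ports: "e \<in> F \<Longrightarrow> card (ports e) = 2"
begin

abbreviation "perms \<equiv> permutations_of_set F"
abbreviation "m \<equiv> card F"

lemma permsD:
  assumes "\<pi> \<in> perms"
  shows "distinct \<pi>" "set \<pi> = F" "length \<pi> = m"
  using assms permutations_of_setD length_finite_permutations_of_set by blast+

lemma perms_nth: "\<pi> \<in> perms \<Longrightarrow> s < m \<Longrightarrow> \<pi> ! s \<in> F"
  using permsD[of \<pi>] nth_mem[of s \<pi>] by simp

lemma card_perms: "card perms = fact m"
  using finite_F by simp

lemma finite_ports: "e \<in> F \<Longrightarrow> finite (ports e)"
  using card_ports by (metis card.infinite zero_neq_numeral)

lemma ports_eq: "e \<in> F \<Longrightarrow> q \<in> ports e \<Longrightarrow> r \<in> ports e \<Longrightarrow> r \<noteq> q \<Longrightarrow> ports e = {q, r}"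
  using card_ports[of e] by (auto simp: card_2_iff)

text \<open>Each swap exchanges position \<open>s\<close> with the position of the newly queried
  edge, and these positions decrease along the walk. So nothing before the original position of the
  current edge has been touched.\<close>

lemma rot_invariant:
  assumes "rot \<pi> s p e q \<sigma>" "\<pi> \<in> perms"
  shows "\<sigma> \<in> perms \<and> s < m \<and> \<sigma> ! s = e \<and> q \<in> ports e \<and>
    (\<exists>i\<le>s. \<pi> ! i = e \<and> take i \<sigma> = take i \<pi>)"
  using assms
proof (induction rule: rot.induct)
  case start
  then show ?case using permsD by auto
next
  case (step e q \<sigma> x r)
  note \<pi> = permsD[OF step.prems]
  obtain i where i: "i \<le> s" "\<pi> ! i = e" "take i \<sigma> = take i \<pi>" and \<sigma>: "\<sigma> \<in> perms" "s < m" "\<sigma> ! s = e"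
    using step by blast
  note \<sigma>' = permsD[OF \<sigma>(1)]
  obtain j i' where j: "j < i'" "i' < length \<pi>" "\<pi> ! j = x" "\<pi> ! i' = e"
    using step.hyps(2) unfolding child_def by blast
  have "i' = i" using nth_eq_iff_index_eq[of \<pi> i' i] \<pi> i j \<sigma>(2) by simp
  then have ji: "j < i" using j by simp
  have "map (transpose e x) \<sigma> \<in> perms"
    using map_transpose_perm[OF \<sigma>(1)] child_in_set[OF step.hyps(2)] \<pi> by blast
  moreover have "map (transpose e x) \<sigma> ! s = x"
    using \<sigma> \<sigma>' by simp
  moreover have "take j (map (transpose e x) \<sigma>) = take j \<pi>"
  proof -
    have "take j \<sigma> = take j \<pi>"
      using i(3) ji by (metis min.absorb1 order_less_imp_le take_take)
    moreover have "e \<notin> set (take j \<pi>)" "x \<notin> set (take j \<pi>)"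
      using nth_notin_take[of \<pi> j i] nth_notin_take[of \<pi> j j] \<pi> i j ji \<sigma>(2) by auto
    ultimately show ?thesis by (simp add: take_map map_transpose_id)
  qed
  ultimately show ?case
    using \<sigma>(2) step.hyps(5) j(3) ji i(1) by (intro conjI exI[of _ j]) auto
qed

lemma rot_index:
  assumes "rot \<pi> s p e q \<sigma>" "\<pi> \<in> perms" "child \<pi> e x"
  obtains j where "j < s" "\<pi> ! j = x" "\<sigma> ! j = x" "take j \<sigma> = take j \<pi>" "free (take j \<pi>) e"
    "conflicting e x" "e \<notin> set (take j \<pi>)" "x \<notin> set (take j \<pi>)"
proof -
  note \<pi> = permsD[OF assms(2)]
  obtain i where i: "i \<le> s" "\<pi> ! i = e" "take i \<sigma> = take i \<pi>" and \<sigma>: "\<sigma> \<in> perms" "s < m" "\<sigma> ! s = e"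
    using rot_invariant[OF assms(1,2)] by blast
  obtain j i' where j: "j < i'" "i' < length \<pi>" "\<pi> ! j = x" "\<pi> ! i' = e" "free (take j \<pi>) e" "conflicting e x"
    using assms(3) unfolding child_def by blast
  have "i' = i" using nth_eq_iff_index_eq[of \<pi> i' i] \<pi> i j \<sigma>(2) by simp
  then have ji: "j < i" using j by simp
  have 1: "take j \<sigma> = take j \<pi>"
    using i(3) ji by (metis min.absorb1 order_less_imp_le take_take)
  have 2: "e \<notin> set (take j \<pi>)" "x \<notin> set (take j \<pi>)"
    using nth_notin_take[of \<pi> j i] nth_notin_take[of \<pi> j j] \<pi> i j ji \<sigma>(2) by auto
  have "\<sigma> ! j = x" using i(3) ji j(3) by (metis nth_take)
  then show ?thesis using that[of j] 1 2 j ji i(1) by simp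
qed

text \<open>The rotation never moves \<open>e\<close> to an earlier position, and it leaves the
  prefix before each edge queried by \<open>e\<close> unchanged.\<close>

lemma rot_children:
  assumes "rot \<pi> s p e q \<sigma>" "\<pi> \<in> perms"
  shows "children \<pi> e \<subseteq> children \<sigma> e"
proof
  fix x assume "x \<in> children \<pi> e"
  then have x: "child \<pi> e x" by (simp add: children_def)
  from rot_index[OF assms x] obtain j where j: "j < s" "\<sigma> ! j = x" "take j \<sigma> = take j \<pi>"
    "free (take j \<pi>) e" "conflicting e x" by metis
  have "s < length \<sigma>" "\<sigma> ! s = e" using rot_invariant[OF assms] permsD by auto
  then show "x \<in> children \<sigma> e"
    using j unfolding children_def child_def
    by (intro CollectI exI[of _ j] exI[of _ s]) auto
qed

text \<open>The exchange puts \<open>e\<close> at position \<open>j\<close>, behind an unchanged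
  prefix in which it is free, so greedy takes it there.\<close>

lemma transpose_matched:
  assumes \<sigma>: "\<sigma> \<in> perms" and "j < s" "s < m" "\<sigma> ! s = e" "\<sigma> ! j = x" "free (take j \<sigma>) e"
  shows "e \<in> greedy (take s (map (transpose e x) \<sigma>))"
proof -
  note \<sigma>' = permsD[OF \<sigma>]
  let ?\<tau> = "map (transpose e x) \<sigma>"
  have "e \<notin> set (take j \<sigma>)" "x \<notin> set (take j \<sigma>)"
    using nth_notin_take[of \<sigma> j s] nth_notin_take[of \<sigma> j j] \<sigma>' assms by auto
  then have "take j ?\<tau> = take j \<sigma>" by (simp add: take_map map_transpose_id)
  moreover have "take (Suc j) ?\<tau> = take j ?\<tau> @ [e]"
    using assms \<sigma>' by (simp add: take_Suc_conv_app_nth)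
  ultimately have "e \<in> greedy (take (Suc j) ?\<tau>)"
    using assms(6) by (simp add: greedy_snoc)
  then show ?thesis
    using greedy_take_mono[of "Suc j" s ?\<tau>] assms(2) by auto
qed

lemma rot_matched:
  assumes "rot \<pi> s p e q \<sigma>" "\<pi> \<in> perms" "child \<pi> e x"
  shows "e \<in> greedy (take s (map (transpose e x) \<sigma>))"
proof -
  from rot_index[OF assms] obtain j where "j < s" "\<sigma> ! j = x" "take j \<sigma> = take j \<pi>"
    "free (take j \<pi>) e" by metis
  then show ?thesis
    using transpose_matched[of \<sigma> j s e x] rot_invariant[OF assms(1,2)] by auto
qed

text \<open>Each step of the rotation is undone by looking up the edge matched before position \<open>s\<close> at the
entry port; there is none exactly when the walk has been undone completely.\<close>

lemma rot_unique:
  assumes "rot \<pi> s p e q \<sigma>" "rot \<pi>' s p' e' q \<sigma>" "\<pi> \<in> perms" "\<pi>' \<in> perms"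
  shows "\<pi> = \<pi>' \<and> p = p'"
  using assms
proof (induction arbitrary: e' rule: rot.induct)
  case start
  from start.prems(1) show ?case
  proof cases
    case (step e1 q1 \<sigma>1)
    from rot_matched[OF step(2) start.prems(3) step(3)] have "e1 \<in> greedy (take s \<pi>)"
      using step(1) by simp
    then show ?thesis using start.hyps(3) step(4) unfolding port_free_def by blast
  qed auto
next
  case (step e q \<sigma> x r)
  let ?\<sigma> = "map (transpose e x) \<sigma>"
  have e: "e \<in> greedy (take s ?\<sigma>)" using rot_matched step by blast
  have s: "?\<sigma> ! s = x" using rot_invariant[OF rot.step] step by blast
  have s': "?\<sigma> ! s = e'" using rot_invariant step.prems by blast
  from step.prems(1) show ?case
  proof cases
    case start
    then show ?thesis using e step.hyps(3) unfolding port_free_def by blast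
  next
    case (step e1 q1 \<sigma>1)
    have "e1 \<in> greedy (take s ?\<sigma>)"
      using rot_matched[OF step(2) \<open>\<pi>' \<in> perms\<close> step(3)] step(1) by simp
    then have ee: "e1 = e"
      using greedy_port_unique e step(4) \<open>r \<in> ports e\<close> by blast
    have x: "e' = x" using s s' by simp
    have "\<sigma>1 = \<sigma>" using step(1) inj_map_transpose unfolding ee x by metis
    \<comment> \<open>The walk leaves \<open>e\<close> through \<open>r\<close>; as \<open>e\<close>
      has only two ports, the entry port is the other one.\<close>
    moreover have "q1 = q"
    proof -
      have "e \<in> F" using child_in_set[OF \<open>child \<pi> e x\<close>] permsD \<open>\<pi> \<in> perms\<close> by blast
      moreover have "q \<in> ports e" using rot_invariant \<open>rot \<pi> s p e q \<sigma>\<close> \<open>\<pi> \<in> perms\<close> by blast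
      moreover have "q1 \<in> ports e" using rot_invariant[OF step(2)] \<open>\<pi>' \<in> perms\<close> ee by blast
      ultimately show ?thesis
        using ports_eq[of e q r] step(4,5) \<open>r \<in> ports e\<close> \<open>r \<noteq> q\<close> by auto
    qed
    ultimately show ?thesis
      using \<open>\<And>e'. rot \<pi>' s p' e' q \<sigma> \<Longrightarrow> \<pi> \<in> perms \<Longrightarrow> \<pi>' \<in> perms \<Longrightarrow> \<pi> = \<pi>' \<and> p = p'\<close>
        step(2) \<open>\<pi> \<in> perms\<close> \<open>\<pi>' \<in> perms\<close> by blast
  qed
qed

text \<open>Starts a walk: \<open>f\<close> occupies \<open>p\<close> and is still free when
  \<open>x\<close> is reached, so no earlier edge is matched at \<open>p\<close>.\<close>

lemma child_imp_rot:
  assumes "\<pi> \<in> perms" "child \<pi> f x" "p \<in> ports f" "p \<in> ports x"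
  obtains s where "rot \<pi> s p x p \<pi>" "child \<pi> f (\<pi> ! s)"
proof -
  note \<pi> = permsD[OF assms(1)]
  obtain j k where j: "j < k" "k < length \<pi>" "\<pi> ! j = x" "\<pi> ! k = f" "free (take j \<pi>) f"
    using assms(2) unfolding child_def by blast
  have "port_free (take j \<pi>) p"
    using free_port_free[OF j(5) _ assms(3)] nth_notin_take[of \<pi> j k] \<pi> j by auto
  then have "rot \<pi> j p (\<pi> ! j) p \<pi>"
    using j assms(4) by (intro rot.start) auto
  with that[of j] show ?thesis using j assms(2) by auto
qed

text \<open>If a walk turns back to the port through which it entered an edge, then that edge can
be bypassed, so reachability is witnessed by walks that leave every edge through its other port.\<close>

lemma reach_imp_rot:
  assumes "\<pi> \<in> perms" "(child \<pi>)\<^sup>*\<^sup>* f e"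
  shows "e = f \<or> (\<exists>s p q \<sigma>. rot \<pi> s p e q \<sigma> \<and> child \<pi> f (\<pi> ! s) \<and> p \<in> ports f)"
  using assms(2)
proof (induction rule: rtranclp_induct)
  case (step e x)
  note d = permsD(1)[OF assms(1)]
  obtain r where r: "r \<in> ports e" "r \<in> ports x"
    using step.hyps(2) unfolding child_def conflicting_iff by blast
  from step.IH show ?case
  proof
    assume "e = f"
    then show ?thesis using child_imp_rot[OF assms(1)] step.hyps(2) r by metis
  next
    assume "\<exists>s p q \<sigma>. rot \<pi> s p e q \<sigma> \<and> child \<pi> f (\<pi> ! s) \<and> p \<in> ports f"
    then obtain s p q \<sigma> where w: "rot \<pi> s p e q \<sigma>" "child \<pi> f (\<pi> ! s)" "p \<in> ports f" by blast
    show ?thesis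
    proof (cases "r = q")
      case False
      then show ?thesis using rot.step[OF w(1) step.hyps(2) r(1) _ r(2)] w by blast
    next
      case True
      from w(1) show ?thesis
      proof cases
        \<comment> \<open>The walk is \<open>e\<close> alone and turns back at \<open>p\<close>, a
          port of \<open>f\<close>. Then \<open>f\<close> queries \<open>x\<close> itself, and a new
          walk starts at \<open>x\<close>.\<close>
        case start
        then have "child \<pi> f x"
          using child_trans[OF d, of f e x p] w step.hyps(2) r True by auto
        then show ?thesis using child_imp_rot[OF assms(1) _ w(3)] w(3) r True start by metis
      next
        \<comment> \<open>The predecessor \<open>e1\<close> also occupies \<open>q\<close>, so it
          queries \<open>x\<close> directly and \<open>e\<close> is dropped from the walk.\<close>
        case (step e1 q1 \<sigma>1)
        have "child \<pi> e1 x"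
          using child_trans[OF d step(3) \<open>child \<pi> e x\<close>] step(4) r(2) True by blast
        then show ?thesis
          using rot.step[OF step(2), of x q] step r(2) True w by blast
      qed
    qed
  qed
qed simp

text \<open>Exchanging \<open>\<sigma> ! s\<close> with a queried edge \<open>x\<close> makes it matched, and \<open>x\<close> has at most two matched
neighbours.\<close>

lemma card_children_at:
  assumes "s < m"
  shows "card (SIGMA \<sigma>:perms. children \<sigma> (\<sigma> ! s)) \<le> 2 * fact m"
proof -
  let ?A = "SIGMA \<sigma>:perms. children \<sigma> (\<sigma> ! s)"
  \<comment> \<open>The target of the injection: two ports at position \<open>s\<close> for each
    ranking, which gives the factor 2.\<close>
  let ?B = "SIGMA \<tau>:perms. ports (\<tau> ! s)"
  let ?rel = "\<lambda>(\<sigma>, x) (\<tau>, q). \<tau> = map (transpose (\<sigma> ! s) x) \<sigma> \<and> \<tau> ! s = x \<and> q \<in> ports x \<and>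
    q \<in> ports (\<sigma> ! s) \<and> \<sigma> ! s \<in> greedy (take s \<tau>)"
  have ex: "\<exists>b\<in>?B. ?rel a b" if "a \<in> ?A" for a
  proof -
    obtain \<sigma> x where ax: "a = (\<sigma>, x)" by (metis prod.exhaust)
    with that have a: "a = (\<sigma>, x)" "\<sigma> \<in> perms" "child \<sigma> (\<sigma> ! s) x"
      unfolding children_def by auto
    note \<sigma> = permsD[OF a(2)]
    obtain j k where j: "j < k" "k < length \<sigma>" "\<sigma> ! j = x" "\<sigma> ! k = \<sigma> ! s"
      "conflicting (\<sigma> ! s) x" "free (take j \<sigma>) (\<sigma> ! s)"
      using a(3) unfolding child_def by blast
    have "k = s" using j \<sigma> assms by (metis nth_eq_iff_index_eq)
    then have m: "\<sigma> ! s \<in> greedy (take s (map (transpose (\<sigma> ! s) x) \<sigma>))"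
      using transpose_matched[OF a(2) _ assms refl j(3,6)] j by simp
    obtain q where q: "q \<in> ports x" "q \<in> ports (\<sigma> ! s)"
      using j(5) unfolding conflicting_iff by blast
    have "map (transpose (\<sigma> ! s) x) \<sigma> \<in> perms"
      using map_transpose_perm[OF a(2)] child_in_set[OF a(3)] \<sigma> by blast
    then show ?thesis
      using q m \<sigma> assms unfolding a(1)
      by (intro bexI[of _ "(map (transpose (\<sigma> ! s) x) \<sigma>, q)"]) auto
  qed
  define g where "g a = (SOME b. b \<in> ?B \<and> ?rel a b)" for a
  have g: "g a \<in> ?B \<and> ?rel a (g a)" if "a \<in> ?A" for a
    unfolding g_def by (rule someI_ex) (use ex[OF that] in blast)
  have inj: "inj_on g ?A"
  proof (rule inj_onI)
    fix a a' assume a: "a \<in> ?A" "a' \<in> ?A" "g a = g a'"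
    obtain \<sigma> x \<sigma>' x' where p: "a = (\<sigma>, x)" "a' = (\<sigma>', x')" by (metis prod.exhaust)
    obtain \<tau> q where t: "g a = (\<tau>, q)" by (metis prod.exhaust)
    have 1: "\<tau> = map (transpose (\<sigma> ! s) x) \<sigma>" "\<tau> ! s = x" "q \<in> ports (\<sigma> ! s)" "\<sigma> ! s \<in> greedy (take s \<tau>)"
      using g[OF a(1)] unfolding t unfolding p by auto
    have 2: "\<tau> = map (transpose (\<sigma>' ! s) x') \<sigma>'" "\<tau> ! s = x'" "q \<in> ports (\<sigma>' ! s)" "\<sigma>' ! s \<in> greedy (take s \<tau>)"
      using g[OF a(2)] unfolding a(3)[symmetric] t unfolding p by auto
    \<comment> \<open>Both edges are matched in the same prefix of \<open>\<tau>\<close> and occupy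
      \<open>q\<close>. Since \<open>x\<close> is read off at position \<open>s\<close>, the
      transposition can then be undone.\<close>
    have "\<sigma> ! s = \<sigma>' ! s" using greedy_port_unique 1 2 by blast
    then show "a = a'" using 1 2 inj_map_transpose p by metis
  qed
  have fin: "finite ?B"
    using assms by (intro finite_SigmaI) (auto intro!: finite_ports perms_nth)
  have "card ?A \<le> card ?B"
    using card_inj_on_le[OF inj _ fin] g by blast
  also have "card ?B = (\<Sum>\<tau>\<in>perms. card (ports (\<tau> ! s)))"
    using assms by (intro card_SigmaI) (auto intro!: finite_ports perms_nth)
  also have "\<dots> = (\<Sum>\<tau>\<in>perms. 2)"
    using assms by (intro sum.cong) (auto intro!: card_ports perms_nth)
  also have "\<dots> = 2 * fact m" using card_perms by simp
  finally show ?thesis .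
qed

subsection \<open>Counting triples\<close>

lemma finite_alive [simp]: "finite (alive F us p)"
  using finite_F by (simp add: alive_def)

lemma child_alive:
  assumes "\<pi> \<in> perms" "child \<pi> f (\<pi> ! s)" "s < m" "p \<in> ports f"
  shows "f \<in> alive F (take s \<pi>) p"
proof -
  note \<pi> = permsD[OF assms(1)]
  obtain j k where j: "j < k" "k < length \<pi>" "\<pi> ! j = \<pi> ! s" "\<pi> ! k = f" "free (take j \<pi>) f"
    using assms(2) unfolding child_def by blast
  have "j = s" using nth_eq_iff_index_eq[of \<pi> j s] \<pi> j assms(3) by simp
  then show ?thesis
    using j \<pi> nth_notin_take[of \<pi> s k] perms_nth[OF assms(1), of k] assms(4)
    unfolding alive_def by auto
qed

text \<open>A triple is encoded by the rotated ranking \<open>\<sigma>\<close>, the edge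
  \<open>x\<close> and the entry port \<open>q\<close>. The code determines \<open>\<pi>\<close> and
  \<open>p\<close> by \<open>rot_unique\<close>, and \<open>e\<close> as
  \<open>\<sigma> ! s\<close>, leaving at most \<open>D\<close> edges \<open>f\<close>. The 4 is two
  for \<open>x\<close> on average times two for \<open>q\<close>.\<close>

lemma card_good_triples:
  fixes D :: real
  assumes "s < m" "D \<ge> 0"
  shows "real (card {(\<pi>, f, e, x). \<pi> \<in> perms \<and> (\<forall>p. card (alive F (take s \<pi>) p) \<le> D) \<and>
      (\<exists>p q \<sigma>. rot \<pi> s p e q \<sigma> \<and> f \<in> alive F (take s \<pi>) p) \<and> x \<in> children \<pi> e}) \<le> 4 * fact m * D"
    (is "real (card ?T) \<le> _")
proof -
  let ?W = "SIGMA y:(SIGMA \<sigma>:perms. children \<sigma> (\<sigma> ! s)). ports (fst y ! s)"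
  define G where "G w = {(\<pi>, f, e, x). \<pi> \<in> perms \<and> (\<forall>p. card (alive F (take s \<pi>) p) \<le> D) \<and>
      (\<exists>p. rot \<pi> s p e (snd w) (fst (fst w)) \<and> f \<in> alive F (take s \<pi>) p) \<and> x = snd (fst w)}"
    for w :: "(pedge list \<times> pedge) \<times> nat \<times> nat"
  have G: "finite (G w) \<and> card (G w) \<le> D" for w
  proof (cases "G w = {}")
    case True
    then show ?thesis using assms(2) by simp
  next
    case False
    then obtain \<pi> p e where \<pi>: "\<pi> \<in> perms" "\<forall>p. card (alive F (take s \<pi>) p) \<le> D"
      "rot \<pi> s p e (snd w) (fst (fst w))"
      unfolding G_def by blast
    have sub: "G w \<subseteq> (\<lambda>f. (\<pi>, f, e, snd (fst w))) ` alive F (take s \<pi>) p"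
    proof
      fix t assume "t \<in> G w"
      then obtain \<pi>' f e' p' where t: "t = (\<pi>', f, e', snd (fst w))" "\<pi>' \<in> perms"
        "rot \<pi>' s p' e' (snd w) (fst (fst w))" "f \<in> alive F (take s \<pi>') p'"
        unfolding G_def by blast
      have "\<pi>' = \<pi>" "p' = p" using rot_unique[OF t(3) \<pi>(3) t(2) \<pi>(1)] by auto
      moreover have "e' = e"
        using rot_invariant[OF t(3,2)] rot_invariant[OF \<pi>(3,1)] by blast
      ultimately show "t \<in> (\<lambda>f. (\<pi>, f, e, snd (fst w))) ` alive F (take s \<pi>) p"
        using t by blast
    qed
    have "card (G w) \<le> card (alive F (take s \<pi>) p)"
      by (rule surj_card_le[OF finite_alive sub])
    moreover have "card (alive F (take s \<pi>) p) \<le> D" using \<pi>(2) by blast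
    ultimately show ?thesis using finite_subset[OF sub] by (simp add: le_trans)
  qed
  have fin0: "finite (SIGMA \<sigma>:perms. children \<sigma> (\<sigma> ! s))"
    by (intro finite_SigmaI) auto
  have fin: "finite ?W"
    using fin0 assms(1) by (intro finite_SigmaI) (auto intro!: finite_ports perms_nth)
  have "card ?W = (\<Sum>y\<in>(SIGMA \<sigma>:perms. children \<sigma> (\<sigma> ! s)). card (ports (fst y ! s)))"
    using fin0 assms(1) by (intro card_SigmaI) (auto intro!: finite_ports perms_nth)
  also have "\<dots> = (\<Sum>y\<in>(SIGMA \<sigma>:perms. children \<sigma> (\<sigma> ! s)). 2)"
    using assms(1) by (intro sum.cong) (auto intro!: card_ports perms_nth)
  finally have W: "card ?W \<le> 4 * fact m"
    using card_children_at[OF assms(1)] by simp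
  have sub: "?T \<subseteq> (\<Union>w\<in>?W. G w)"
  proof
    fix t assume "t \<in> ?T"
    then obtain \<pi> f e x p q \<sigma> where t: "t = (\<pi>, f, e, x)" "\<pi> \<in> perms"
      "\<forall>p. card (alive F (take s \<pi>) p) \<le> D" "rot \<pi> s p e q \<sigma>" "f \<in> alive F (take s \<pi>) p"
      "x \<in> children \<pi> e" by blast
    note i = rot_invariant[OF t(4,2)]
    have "t \<in> G ((\<sigma>, x), q)" using t unfolding G_def by (simp del: split_paired_Ex split_paired_All) blast
    moreover have "((\<sigma>, x), q) \<in> ?W"
      using i rot_children[OF t(4,2)] t(6) by auto
    ultimately show "t \<in> (\<Union>w\<in>?W. G w)" by blast
  qed
  have "finite (\<Union>w\<in>?W. G w)" using fin G by blast
  then have "card ?T \<le> card (\<Union>w\<in>?W. G w)" by (rule card_mono[OF _ sub])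
  also have "\<dots> \<le> (\<Sum>w\<in>?W. card (G w))" by (rule card_UN_le[OF fin])
  finally have "real (card ?T) \<le> (\<Sum>w\<in>?W. real (card (G w)))"
    by (simp only: of_nat_sum[symmetric] of_nat_le_iff)
  also have "\<dots> \<le> (\<Sum>w\<in>?W. D)" using G by (intro sum_mono) blast
  also have "\<dots> = real (card ?W) * D" by simp
  also have "\<dots> \<le> real (4 * fact m) * D"
    using W assms(2) by (intro mult_right_mono) (simp_all only: of_nat_le_iff)
  finally show ?thesis by simp
qed

section \<open>Concentration: crowded ports are rare\<close>

definition crowded :: "nat \<Rightarrow> nat \<times> nat \<Rightarrow> real \<Rightarrow> pedge list set" where
  "crowded s p D = {us. length us = s \<and> distinct us \<and> set us \<subseteq> F \<and> real (card (alive F us p)) > D}"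

lemma finite_crowded [simp]: "finite (crowded s p D)"
  by (rule finite_subset[OF _ finite_lists_length_eq[OF finite_F, of s]]) (auto simp: crowded_def)

text \<open>A port stays crowded only if the next edge avoids all edges alive at it: such an edge would
be matched, leaving no edge alive at the port.\<close>

lemma crowded_snoc:
  assumes "us @ [y] \<in> crowded (Suc s) p D" "D \<ge> 0"
  shows "us \<in> crowded s p D" "y \<in> F - set us - alive F us p"
proof -
  have us: "length us = s" "distinct us" "set us \<subseteq> F" "y \<notin> set us" "y \<in> F"
    "card (alive F (us @ [y]) p) > D"
    using assms(1) unfolding crowded_def by auto
  have sub: "alive F (us @ [y]) p \<subseteq> alive F us p"
    by (auto simp: alive_def greedy_snoc free_def split: if_splits)
  have "card (alive F (us @ [y]) p) \<le> card (alive F us p)"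
    by (rule card_mono[OF finite_alive sub])
  then show "us \<in> crowded s p D"
    using us unfolding crowded_def by (auto intro: less_le_trans)
  have "y \<notin> alive F us p"
  proof
    assume "y \<in> alive F us p"
    then have y: "free us y" "p \<in> ports y" by (auto simp: alive_def)
    have "\<not> (p \<in> ports f \<and> free (us @ [y]) f)" if "f \<noteq> y" for f
    proof
      assume f: "p \<in> ports f \<and> free (us @ [y]) f"
      then have "\<not> conflicting f y" using y(1) unfolding free_def greedy_snoc by simp
      then show False using f y(2) that unfolding conflicting_iff by blast
    qed
    then have "alive F (us @ [y]) p = {}" unfolding alive_def by auto
    then show False using us(6) assms(2) by simp
  qed
  then show "y \<in> F - set us - alive F us p" using us by blast
qed

lemma card_crowded_Suc:
  assumes "s < m" "D \<ge> 0"
  shows "real (card (crowded (Suc s) p D)) \<le> card (crowded s p D) * (real (m - s) * exp (- D / m))"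
proof -
  let ?X = "\<lambda>us. F - set us - alive F us p"
  have sub: "crowded (Suc s) p D \<subseteq> (\<Union>us\<in>crowded s p D. (\<lambda>y. us @ [y]) ` ?X us)"
  proof
    fix vs assume vs: "vs \<in> crowded (Suc s) p D"
    then have "vs \<noteq> []" by (auto simp: crowded_def)
    then obtain us y where "vs = us @ [y]" by (metis rev_exhaust)
    then show "vs \<in> (\<Union>us\<in>crowded s p D. (\<lambda>y. us @ [y]) ` ?X us)"
      using crowded_snoc[of us y s p D] vs assms(2) by blast
  qed
  have X: "real (card (?X us)) \<le> real (m - s) * exp (- D / m)" if "us \<in> crowded s p D" for us
  proof -
    have us: "length us = s" "distinct us" "set us \<subseteq> F" "card (alive F us p) > D"
      using that by (auto simp: crowded_def)
    have "alive F us p \<subseteq> F - set us" by (auto simp: alive_def)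
    then have "card (?X us) = card (F - set us) - card (alive F us p)"
      "card (alive F us p) \<le> card (F - set us)"
      using finite_F by (auto intro!: card_Diff_subset card_mono)
    moreover have "card (F - set us) = m - s"
      using us distinct_card[of us] by (simp add: card_Diff_subset)
    ultimately have "real (card (?X us)) \<le> real (m - s) - D"
      using us(4) by (simp add: of_nat_diff)
    also have "\<dots> \<le> real (m - s) * (1 + (- D / m))"
    proof -
      have "real (m - s) * (D / m) \<le> real m * (D / m)"
        using assms by (intro mult_right_mono) auto
      also have "\<dots> = D" using assms by simp
      finally show ?thesis by (simp add: algebra_simps)
    qed
    also have "\<dots> \<le> real (m - s) * exp (- D / m)"
      by (intro mult_left_mono exp_ge_add_one_self) auto
    finally show ?thesis .
  qed
  have fin: "finite (\<Union>us\<in>crowded s p D. (\<lambda>y. us @ [y]) ` ?X us)"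
    using finite_F by auto
  have "card (crowded (Suc s) p D) \<le> card (\<Union>us\<in>crowded s p D. (\<lambda>y. us @ [y]) ` ?X us)"
    by (rule card_mono[OF fin sub])
  also have "\<dots> \<le> (\<Sum>us\<in>crowded s p D. card ((\<lambda>y. us @ [y]) ` ?X us))"
    by (rule card_UN_le) simp
  also have "\<dots> \<le> (\<Sum>us\<in>crowded s p D. card (?X us))"
    using finite_F by (intro sum_mono card_image_le) auto
  finally have "real (card (crowded (Suc s) p D)) \<le> (\<Sum>us\<in>crowded s p D. real (card (?X us)))"
    by (simp only: of_nat_sum[symmetric] of_nat_le_iff)
  also have "\<dots> \<le> (\<Sum>us\<in>crowded s p D. real (m - s) * exp (- D / m))"
    using X by (intro sum_mono)
  finally show ?thesis by simp
qed

text \<open>The factor \<open>fact (m - s)\<close> counts the completions of a prefix, so the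
  iterated bound compares directly with the number of all rankings.\<close>

lemma card_crowded:
  fixes D :: real
  assumes "s \<le> m" "D \<ge> 0"
  shows "real (card (crowded s p D)) * fact (m - s) \<le> exp (- D * s / m) * fact m"
  using assms(1)
proof (induction s)
  case 0
  have "crowded 0 p D \<subseteq> {[]}" by (auto simp: crowded_def)
  then have "card (crowded 0 p D) \<le> 1"
    using card_mono[of "{[]}" "crowded 0 p D"] by simp
  then show ?case by simp
next
  case (Suc s)
  have f: "(fact (m - s) :: real) = real (m - s) * fact (m - Suc s)"
    using Suc.prems by (metis Suc_diff_Suc Suc_le_lessD fact_Suc)
  have "real (card (crowded (Suc s) p D)) * fact (m - Suc s)
      \<le> card (crowded s p D) * (real (m - s) * exp (- D / m)) * fact (m - Suc s)"
    using card_crowded_Suc[of s D p] Suc.prems assms(2) by (intro mult_right_mono) auto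
  also have "\<dots> = real (card (crowded s p D)) * fact (m - s) * exp (- D / m)"
    unfolding f by (simp only: mult_ac)
  also have "\<dots> \<le> exp (- D * s / m) * fact m * exp (- D / m)"
    using Suc by (intro mult_right_mono) auto
  also have "\<dots> = exp (- D * s / m + - D / m) * fact m"
    unfolding exp_add by simp
  also have "- D * s / m + - D / m = - D * Suc s / m"
    unfolding add_divide_distrib[symmetric] by (simp add: algebra_simps)
  finally show ?case .
qed

lemma card_perms_crowded:
  fixes D :: real
  assumes "s \<le> m" "D \<ge> 0"
  shows "real (card {\<pi>\<in>perms. card (alive F (take s \<pi>) p) > D}) \<le> exp (- D * s / m) * fact m"
proof -
  let ?P = "\<lambda>us. (@) us ` permutations_of_set (F - set us)"
  have sub: "{\<pi>\<in>perms. card (alive F (take s \<pi>) p) > D} \<subseteq> (\<Union>us\<in>crowded s p D. ?P us)"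
  proof
    fix \<pi> assume \<pi>: "\<pi> \<in> {\<pi>\<in>perms. card (alive F (take s \<pi>) p) > D}"
    then have d: "distinct \<pi>" "set \<pi> = F" "length \<pi> = m" using permsD by auto
    have 1: "take s \<pi> \<in> crowded s p D"
      using \<pi> d assms(1) set_take_subset[of s \<pi>] by (auto simp: crowded_def)
    have "set (take s \<pi>) \<union> set (drop s \<pi>) = F" "set (take s \<pi>) \<inter> set (drop s \<pi>) = {}"
      using d by (metis append_take_drop_id set_append) (metis append_take_drop_id distinct_append d(1))
    then have "drop s \<pi> \<in> permutations_of_set (F - set (take s \<pi>))"
      using d(1) by (intro permutations_of_setI) auto
    then have "\<pi> \<in> ?P (take s \<pi>)"
      by (intro image_eqI[of _ _ "drop s \<pi>"]) auto
    then show "\<pi> \<in> (\<Union>us\<in>crowded s p D. ?P us)" using 1 by blast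
  qed
  have P: "card (?P us) \<le> fact (m - s)" if "us \<in> crowded s p D" for us
  proof -
    have "card (F - set us) = m - s"
      using that distinct_card[of us] by (simp add: card_Diff_subset crowded_def)
    then show ?thesis
      using card_image_le[of "permutations_of_set (F - set us)" "(@) us"] finite_F by simp
  qed
  have "card {\<pi>\<in>perms. card (alive F (take s \<pi>) p) > D} \<le> card (\<Union>us\<in>crowded s p D. ?P us)"
    using sub finite_F by (intro card_mono) auto
  also have "\<dots> \<le> (\<Sum>us\<in>crowded s p D. card (?P us))"
    by (rule card_UN_le) simp
  also have "\<dots> \<le> (\<Sum>us\<in>crowded s p D. fact (m - s))"
    using P by (intro sum_mono)
  finally have "card {\<pi>\<in>perms. card (alive F (take s \<pi>) p) > D} \<le> card (crowded s p D) * fact (m - s)"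
    by simp
  then have "real (card {\<pi>\<in>perms. card (alive F (take s \<pi>) p) > D}) \<le> real (card (crowded s p D) * fact (m - s))"
    by (simp only: of_nat_le_iff)
  then show ?thesis using card_crowded[OF assms, of p] by simp
qed

text \<open>Union bound over the at most \<open>2 * m\<close> ports that occur in \<open>F\<close>;
  at any other port no edge is alive.\<close>

lemma card_perms_some_crowded:
  fixes D :: real
  assumes "s \<le> m" "D \<ge> 0"
  shows "real (card {\<pi>\<in>perms. \<exists>p. card (alive F (take s \<pi>) p) > D}) \<le> 2 * m * exp (- D * s / m) * fact m"
proof -
  let ?R = "\<Union>(ports ` F)"
  have finR: "finite ?R" using finite_F finite_ports by blast
  have "card ?R \<le> (\<Sum>e\<in>F. card (ports e))"
    by (rule card_UN_le[OF finite_F])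
  then have R: "card ?R \<le> 2 * m"
    using card_ports by simp
  have "{\<pi>\<in>perms. \<exists>p. card (alive F (take s \<pi>) p) > D} \<subseteq> (\<Union>p\<in>?R. {\<pi>\<in>perms. card (alive F (take s \<pi>) p) > D})"
  proof
    fix \<pi> assume "\<pi> \<in> {\<pi>\<in>perms. \<exists>p. card (alive F (take s \<pi>) p) > D}"
    then obtain p where p: "\<pi> \<in> perms" "card (alive F (take s \<pi>) p) > D" by blast
    then have "alive F (take s \<pi>) p \<noteq> {}" using assms(2) by auto
    then have "p \<in> ?R" by (auto simp: alive_def)
    then show "\<pi> \<in> (\<Union>p\<in>?R. {\<pi>\<in>perms. card (alive F (take s \<pi>) p) > D})" using p by blast
  qed
  then have "card {\<pi>\<in>perms. \<exists>p. card (alive F (take s \<pi>) p) > D} \<le> card (\<Union>p\<in>?R. {\<pi>\<in>perms. card (alive F (take s \<pi>) p) > D})"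
    by (rule card_mono[rotated]) (rule finite_UN_I[OF finR], simp)
  also have "\<dots> \<le> (\<Sum>p\<in>?R. card {\<pi>\<in>perms. card (alive F (take s \<pi>) p) > D})"
    by (rule card_UN_le[OF finR])
  finally have "real (card {\<pi>\<in>perms. \<exists>p. card (alive F (take s \<pi>) p) > D})
      \<le> (\<Sum>p\<in>?R. real (card {\<pi>\<in>perms. card (alive F (take s \<pi>) p) > D}))"
    by (simp only: of_nat_sum[symmetric] of_nat_le_iff)
  also have "\<dots> \<le> (\<Sum>p\<in>?R. exp (- D * s / m) * fact m)"
    using card_perms_crowded[OF assms] by (intro sum_mono)
  also have "\<dots> = real (card ?R) * (exp (- D * s / m) * fact m)" by simp
  also have "\<dots> \<le> real (2 * m) * (exp (- D * s / m) * fact m)"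
    using R by (intro mult_right_mono) (simp_all only: of_nat_le_iff, simp)
  finally show ?thesis by simp
qed

section \<open>Summation over positions\<close>

definition triples :: "pedge list \<Rightarrow> (pedge \<times> pedge \<times> pedge) set" where
  "triples \<pi> = {(f, e, x). f \<in> F \<and> (child \<pi>)\<^sup>*\<^sup>* f e \<and> x \<in> children \<pi> e}"

lemma finite_triples:
  assumes "\<pi> \<in> perms"
  shows "triples \<pi> \<subseteq> F \<times> F \<times> F" "finite (triples \<pi>)"
proof -
  show "triples \<pi> \<subseteq> F \<times> F \<times> F"
    using permsD[OF assms] child_in_set unfolding triples_def children_def by blast
  then show "finite (triples \<pi>)" using finite_F by (meson finite_SigmaI finite_subset)
qed

text \<open>Each triple is charged to a position \<open>s\<close>: that of \<open>f\<close> if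
  \<open>e = f\<close>, otherwise that of the first edge of the walk after \<open>f\<close>. A
  ranking with a crowded port at \<open>s\<close> is charged all of
  \<open>F \<times> F \<times> F\<close>, whence \<open>m ^ 3\<close>.\<close>

lemma sum_card_triples:
  fixes D :: "nat \<Rightarrow> real"
  assumes "\<And>s. D s \<ge> 0"
  shows "(\<Sum>\<pi>\<in>perms. real (card (triples \<pi>))) \<le> 2 * m * fact m + 4 * fact m * (\<Sum>s<m. D s) +
     real m ^ 3 * (\<Sum>s<m. real (card {\<pi>\<in>perms. \<exists>p. card (alive F (take s \<pi>) p) > D s}))"
proof -
  let ?bad = "\<lambda>s. {\<pi>\<in>perms. \<exists>p. card (alive F (take s \<pi>) p) > D s}"
  let ?good = "\<lambda>s. {(\<pi>, f, e, x). \<pi> \<in> perms \<and> (\<forall>p. card (alive F (take s \<pi>) p) \<le> D s) \<and>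
      (\<exists>p q \<sigma>. rot \<pi> s p e q \<sigma> \<and> f \<in> alive F (take s \<pi>) p) \<and> x \<in> children \<pi> e}"
  let ?diag = "\<lambda>s. (\<lambda>(\<pi>, x). (\<pi>, \<pi> ! s, \<pi> ! s, x)) ` (SIGMA \<sigma>:perms. children \<sigma> (\<sigma> ! s))"
  let ?all = "\<lambda>s. ?diag s \<union> ?good s \<union> ?bad s \<times> F \<times> F \<times> F"
  have fin0: "finite (SIGMA \<sigma>:perms. children \<sigma> (\<sigma> ! s))" for s
    by (intro finite_SigmaI) auto
  have good: "?good s \<subseteq> perms \<times> F \<times> F \<times> F" if "s < m" for s
  proof
    fix t assume "t \<in> ?good s"
    then obtain \<pi> f e x p q \<sigma> where t: "t = (\<pi>, f, e, x)" "\<pi> \<in> perms"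
      "rot \<pi> s p e q \<sigma>" "f \<in> alive F (take s \<pi>) p" "x \<in> children \<pi> e" by blast
    have "x \<in> F" "e \<in> F"
      using child_in_set permsD(2) t(2,5) unfolding children_def by blast+
    then show "t \<in> perms \<times> F \<times> F \<times> F" using t by (simp add: alive_def)
  qed
  have fin: "finite (?all s)" if "s < m" for s
    using finite_subset[OF good[OF that]] fin0 finite_F by (simp add: finite_SigmaI)
  have sub: "(SIGMA \<pi>:perms. triples \<pi>) \<subseteq> (\<Union>s<m. ?all s)"
  proof
    fix t assume "t \<in> (SIGMA \<pi>:perms. triples \<pi>)"
    then obtain \<pi> f e x where t: "t = (\<pi>, f, e, x)" "\<pi> \<in> perms" "f \<in> F" "(child \<pi>)\<^sup>*\<^sup>* f e" "x \<in> children \<pi> e"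
      unfolding triples_def by auto
    note \<pi> = permsD[OF t(2)]
    from reach_imp_rot[OF t(2,4)] show "t \<in> (\<Union>s<m. ?all s)"
    proof
      assume "e = f"
      moreover obtain s where "s < m" "\<pi> ! s = f" using t(3) \<pi> by (metis in_set_conv_nth)
      ultimately have "t \<in> ?diag s" "s < m" using t by auto
      then show ?thesis by blast
    next
      assume "\<exists>s p q \<sigma>. rot \<pi> s p e q \<sigma> \<and> child \<pi> f (\<pi> ! s) \<and> p \<in> ports f"
      then obtain s p q \<sigma> where w: "rot \<pi> s p e q \<sigma>" "child \<pi> f (\<pi> ! s)" "p \<in> ports f" by blast
      have s: "s < m" using rot_invariant[OF w(1) t(2)] by blast
      have f: "f \<in> alive F (take s \<pi>) p" using child_alive[OF t(2) w(2) s w(3)] .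
      show ?thesis
      proof (cases "\<pi> \<in> ?bad s")
        case True
        have "e \<in> F" "x \<in> F"
          using child_in_set \<pi> t(5) unfolding children_def by blast+
        then show ?thesis using True s t(1,3) by blast
      next
        case False
        then have "\<forall>p. card (alive F (take s \<pi>) p) \<le> D s" using t(2) by (simp add: not_less)
        then have "t \<in> ?good s" using w(1) f t by blast
        then show ?thesis using s by blast
      qed
    qed
  qed
  have fin': "finite (\<Union>s<m. ?all s)" using fin by blast
  have all: "real (card (?all s)) \<le> 2 * fact m + 4 * fact m * D s + real (card (?bad s)) * real m ^ 3"
    if "s < m" for s
  proof -
    have "card (?all s) \<le> card (?diag s \<union> ?good s) + card (?bad s \<times> F \<times> F \<times> F)"
      by (rule card_Un_le)
    also have "\<dots> \<le> (card (?diag s) + card (?good s)) + card (?bad s \<times> F \<times> F \<times> F)"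
      by (intro add_right_mono card_Un_le)
    finally have "real (card (?all s)) \<le> real (card (?diag s)) + real (card (?good s)) + real (card (?bad s \<times> F \<times> F \<times> F))"
      by (simp only: of_nat_add[symmetric] of_nat_le_iff)
    moreover have "card (?diag s) \<le> 2 * fact m"
      using card_image_le[OF fin0] card_children_at[OF that] by (rule order_trans)
    then have "real (card (?diag s)) \<le> 2 * fact m" using of_nat_mono by fastforce
    moreover have "real (card (?good s)) \<le> 4 * fact m * D s"
      by (rule card_good_triples[OF that assms])
    moreover have "real (card (?bad s \<times> F \<times> F \<times> F)) = real (card (?bad s)) * real m ^ 3"
      by (simp add: card_cartesian_product power3_eq_cube)
    ultimately show ?thesis by linarith
  qed
  have "(\<Sum>\<pi>\<in>perms. card (triples \<pi>)) = card (SIGMA \<pi>:perms. triples \<pi>)"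
    using finite_triples(2) by (intro card_SigmaI[symmetric]) auto
  also have "\<dots> \<le> card (\<Union>s<m. ?all s)" by (rule card_mono[OF fin' sub])
  also have "\<dots> \<le> (\<Sum>s<m. card (?all s))" by (rule card_UN_le) simp
  finally have "(\<Sum>\<pi>\<in>perms. real (card (triples \<pi>))) \<le> (\<Sum>s<m. real (card (?all s)))"
    by (simp only: of_nat_sum[symmetric] of_nat_le_iff)
  also have "\<dots> \<le> (\<Sum>s<m. 2 * fact m + 4 * fact m * D s + real (card (?bad s)) * real m ^ 3)"
    using all by (intro sum_mono) simp
  also have "\<dots> = 2 * m * fact m + 4 * fact m * (\<Sum>s<m. D s) + real m ^ 3 * (\<Sum>s<m. real (card (?bad s)))"
    by (simp add: sum.distrib sum_distrib_left algebra_simps)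
  finally show ?thesis .
qed

end

text \<open>Telescoping: \<open>ln y \<le> y - 1\<close> at \<open>y = k / (k + 1)\<close> gives
  \<open>1 / (k + 1) \<le> ln (k + 1) - ln k\<close>.\<close>

lemma sum_inverse_le_ln: "k \<ge> 1 \<Longrightarrow> (\<Sum>s=1..k. 1 / real s) \<le> 1 + ln k"
proof (induction k rule: nat_induct_at_least)
  case (Suc k)
  have "ln (real k / real (Suc k)) \<le> real k / real (Suc k) - 1"
    using Suc.hyps by (intro ln_le_minus_one) auto
  then have "1 / real (Suc k) \<le> ln (Suc k) - ln k"
    using Suc.hyps by (simp add: ln_div field_simps)
  then show ?case using Suc by simp
qed simp

context port_multigraph
begin

lemma sum_card_triples_le:
  fixes l :: real
  assumes "l \<ge> 0" "m > 0"
  shows "(\<Sum>\<pi>\<in>perms. real (card (triples \<pi>)))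
     \<le> fact m * (6 * m + 4 * l * m * (1 + ln m) + 2 * real m ^ 5 * exp (- l))"
proof -
  \<comment> \<open>This choice makes the exponent in the crowding bound equal to \<open>- l\<close>
    for every positive \<open>s\<close>, and it sums to a harmonic series. At 0 the quotient would
    be 0; the value \<open>m\<close> can never be exceeded.\<close>
  define D where "D s = (if s = 0 then real m else l * m / real s)" for s :: nat
  have D: "D s \<ge> 0" for s using assms(1) by (simp add: D_def)
  have "(\<Sum>s<m. D s) \<le> (\<Sum>s\<in>{0..m}. D s)"
    using D by (intro sum_mono2) auto
  also have "\<dots> = m + (\<Sum>s=1..m. l * m * (1 / real s))"
    by (simp add: sum.atLeast_Suc_atMost D_def)
  also have "(\<Sum>s=1..m. l * m * (1 / real s)) = l * m * (\<Sum>s=1..m. 1 / real s)"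
    by (simp only: sum_distrib_left)
  also have "\<dots> \<le> l * m * (1 + ln m)"
    using sum_inverse_le_ln[of m] assms by (intro mult_left_mono) auto
  finally have 1: "(\<Sum>s<m. D s) \<le> m + l * m * (1 + ln m)" by simp
  have "real (card {\<pi>\<in>perms. \<exists>p. card (alive F (take s \<pi>) p) > D s}) \<le> 2 * m * exp (- l) * fact m"
    if "s < m" for s
  proof (cases "s = 0")
    case True
    have "card (alive F (take s \<pi>) p) \<le> m" for \<pi> p
      using finite_F by (intro card_mono) (auto simp: alive_def)
    then have "{\<pi>\<in>perms. \<exists>p. card (alive F (take s \<pi>) p) > D s} = {}"
      using True by (auto simp: D_def not_less)
    then show ?thesis by (simp only: card.empty) simp
  next
    case False
    then have "- D s * s / m = - l" using assms(2) by (simp add: D_def)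
    then show ?thesis using card_perms_some_crowded[of s "D s"] that D by simp
  qed
  then have "(\<Sum>s<m. real (card {\<pi>\<in>perms. \<exists>p. card (alive F (take s \<pi>) p) > D s}))
      \<le> (\<Sum>s<m. 2 * m * exp (- l) * fact m)"
    by (intro sum_mono) simp
  also have "\<dots> = 2 * m^2 * exp (- l) * fact m" by (simp add: power2_eq_square)
  finally have "real m ^ 3 * (\<Sum>s<m. real (card {\<pi>\<in>perms. \<exists>p. card (alive F (take s \<pi>) p) > D s}))
      \<le> real m ^ 3 * (2 * m^2 * exp (- l) * fact m)" by (intro mult_left_mono) auto
  also have "\<dots> = fact m * (2 * real m ^ 5 * exp (- l))" by (simp add: eval_nat_numeral)
  finally have 2: "real m ^ 3 * (\<Sum>s<m. real (card {\<pi>\<in>perms. \<exists>p. card (alive F (take s \<pi>) p) > D s}))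
      \<le> fact m * (2 * real m ^ 5 * exp (- l))" .
  have "4 * fact m * (\<Sum>s<m. D s) \<le> 4 * fact m * (m + l * m * (1 + ln m))"
    using 1 by (intro mult_left_mono) auto
  with 2 sum_card_triples[of D, OF D] show ?thesis
    by (simp add: algebra_simps)
qed

end

subsection \<open>Cost of the memoised recursion\<close>

text \<open>If \<open>P\<close> describes the answers, these are the elements that
  \<open>run_list\<close> really passes to the oracle, the first true one included.\<close>

primrec called :: "('e \<Rightarrow> bool) \<Rightarrow> 'e list \<Rightarrow> 'e list" where
  "called P [] = []"
| "called P (x # xs) = x # (if P x then [] else called P xs)"

lemma called_split: "x \<in> set (called P xs) \<Longrightarrow> \<exists>ys zs. xs = ys @ x # zs \<and> (\<forall>y\<in>set ys. \<not> P y)"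
proof (induction xs)
  case (Cons a xs)
  show ?case
  proof (cases "x = a")
    case True
    then show ?thesis by (intro exI[of _ "[]"] exI[of _ xs]) simp
  next
    case False
    then have "x \<in> set (called P xs)" "\<not> P a" using Cons.prems by (auto split: if_splits)
    then obtain ys zs where "xs = ys @ x # zs" "\<forall>y\<in>set ys. \<not> P y" using Cons.IH by blast
    then show ?thesis using \<open>\<not> P a\<close> by (intro exI[of _ "a # ys"] exI[of _ zs]) simp
  qed
qed simp

lemma filter_eq_appendD:
  "filter P xs = ys @ zs \<Longrightarrow> \<exists>us vs. xs = us @ vs \<and> filter P us = ys \<and> filter P vs = zs"
proof (induction ys arbitrary: xs)
  case Nil
  then show ?case by (intro exI[of _ "[]"] exI[of _ xs]) simp
next
  case (Cons y ys)
  then obtain us vs where 1: "xs = us @ y # vs" "\<forall>u\<in>set us. \<not> P u" "P y" "filter P vs = ys @ zs"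
    by (auto simp: filter_eq_Cons_iff)
  from Cons.IH[OF 1(4)] obtain us' vs' where "vs = us' @ vs'" "filter P us' = ys" "filter P vs' = zs" by blast
  with 1 show ?case by (intro exI[of _ "us @ y # us'"] exI[of _ vs']) simp
qed

lemma set_called: "set (called P xs) \<subseteq> set xs"
  by (induction xs) auto

lemma distinct_called: "distinct xs \<Longrightarrow> distinct (called P xs)"
  using set_called by (induction xs) fastforce+

lemma sum_UNION_le:
  fixes f :: "'b \<Rightarrow> nat"
  assumes "finite I" "\<And>i. i \<in> I \<Longrightarrow> finite (A i)"
  shows "sum f (\<Union>i\<in>I. A i) \<le> (\<Sum>i\<in>I. sum f (A i))"
  using assms
proof (induction I rule: finite_induct)
  case (insert i I)
  then have "finite (A i)" "finite (\<Union>i\<in>I. A i)" by auto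
  from sum.union_inter[OF this, of f] show ?case using insert by simp
qed simp

section \<open>Correctness and amortised cost of the edge oracle\<close>

locale edge_oracle = port_multigraph F for F +
  fixes sel :: "pedge \<Rightarrow> pedge \<Rightarrow> nat" and \<pi> :: "pedge list"
  assumes card_endpoints: "e \<in> F \<Longrightarrow> card (endpoints e) = 2"
    and sel: "valid_sel F sel"
    and perm: "\<pi> \<in> perms"
begin

abbreviation "val e \<equiv> e \<in> greedy \<pi>"

definition reachable :: "pedge \<Rightarrow> pedge set" where
  "reachable e = {x. (child \<pi>)\<^sup>*\<^sup>* e x}"

text \<open>The potential of the amortisation: each stored key contributes an upper bound on the
  calls issued directly by its evaluation.\<close>

definition weight :: "((pedge \<times> nat) \<Rightarrow> bool option) \<Rightarrow> nat" where
  "weight memo = (\<Sum>k\<in>dom memo. card (children \<pi> (fst k)))"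

definition correct :: "((pedge \<times> nat) \<Rightarrow> bool option) \<Rightarrow> bool" where
  "correct memo \<longleftrightarrow> finite (dom memo) \<and> (\<forall>e u b. memo (e, u) = Some b \<longrightarrow> b = val e)"

text \<open>Amortisation: every evaluated key pays for the calls it issues, so the call counter minus the weight of
the memo table grows only with the calls issued from outside.\<close>

definition progress :: "(pedge \<times> nat) set \<Rightarrow> nat \<Rightarrow> ostate \<Rightarrow> ostate \<Rightarrow> bool" where
  "progress S n s s' \<longleftrightarrow> correct (fst s') \<and> dom (fst s) \<subseteq> dom (fst s') \<and>
     dom (fst s') \<subseteq> dom (fst s) \<union> S \<and> snd s' + weight (fst s) \<le> snd s + n + weight (fst s')"

lemma progress_trans:
  "progress S n s s' \<Longrightarrow> progress S' n' s' s'' \<Longrightarrow> progress (S \<union> S') (n + n') s s''"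
  unfolding progress_def by (elim conjE, intro conjI) (assumption | blast | linarith)+

text \<open>Contains every key that a call on \<open>e\<close> can store: recursion stays among
  reachable edges and, by \<open>valid_sel\<close>, passes one of their endpoints.\<close>

definition keys :: "pedge \<Rightarrow> (pedge \<times> nat) set" where
  "keys e = (SIGMA x:reachable e. endpoints x)"

lemma distinct_perm: "distinct \<pi>" and set_perm: "set \<pi> = F" and length_perm: "length \<pi> = m"
  using permsD[OF perm] by auto

text \<open>Every query goes to a strictly lower rank. Hence no recursive call can store the key
  under evaluation.\<close>

lemma reachable_index:
  assumes "x \<in> reachable (\<pi> ! j)" "j < m"
  shows "\<exists>i\<le>j. \<pi> ! i = x"
proof -
  have "(child \<pi>)\<^sup>*\<^sup>* (\<pi> ! j) x" using assms(1) by (simp add: reachable_def)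
  then show ?thesis
  proof (induction rule: rtranclp_induct)
    case (step y z)
    then obtain i where i: "i \<le> j" "\<pi> ! i = y" by blast
    obtain a b where ab: "a < b" "b < length \<pi>" "\<pi> ! a = z" "\<pi> ! b = y"
      using step.hyps(2) unfolding child_def by blast
    have "b = i"
      using nth_eq_iff_index_eq[of \<pi> b i] distinct_perm length_perm ab i assms(2) by simp
    then show ?case using ab i by (intro exI[of _ a]) simp
  qed auto
qed

lemma reachable_subset: "e \<in> F \<Longrightarrow> reachable e \<subseteq> F"
proof
  fix x assume "e \<in> F" "x \<in> reachable e"
  then show "x \<in> F"
    unfolding reachable_def using child_in_set set_perm by (auto elim: rtranclp.cases)
qed

lemma lower_conflicts_nth:
  assumes "k < m"
  shows "lower_conflicts \<pi> (\<pi> ! k) = filter (conflicting (\<pi> ! k)) (take k \<pi>)"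
proof -
  have k: "k < length \<pi>" using assms length_perm by simp
  have "takeWhile (\<lambda>x. x \<noteq> \<pi> ! k) \<pi> = take k \<pi>"
    using k distinct_perm nth_eq_iff_index_eq[OF distinct_perm]
    by (intro takeWhile_eq_take_P_nth) (auto simp: less_trans)
  then show ?thesis by (simp add: lower_conflicts_def)
qed

lemma val_take_iff: "k \<le> m \<Longrightarrow> x \<in> set (take k \<pi>) \<Longrightarrow> val x \<longleftrightarrow> x \<in> greedy (take k \<pi>)"
  using greedy_append_subset[of "take k \<pi>" "drop k \<pi>"] greedy_mono[of "take k \<pi>" "drop k \<pi>"]
    distinct_perm set_take_disj_set_drop_if_distinct[of \<pi> k k] by auto

text \<open>The greedy matching obeys the recursion of the oracle, since the status of all lower
  edges is settled in the prefix.\<close>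

lemma val_nth_iff:
  assumes "k < m"
  shows "val (\<pi> ! k) \<longleftrightarrow> (\<forall>x\<in>set (lower_conflicts \<pi> (\<pi> ! k)). \<not> val x)"
proof -
  have "val (\<pi> ! k) \<longleftrightarrow> free (take k \<pi>) (\<pi> ! k)"
    using nth_mem_greedy_iff distinct_perm assms length_perm by simp
  also have "\<dots> \<longleftrightarrow> (\<forall>x\<in>set (lower_conflicts \<pi> (\<pi> ! k)). \<not> val x)"
    unfolding lower_conflicts_nth[OF assms] free_def
    using val_take_iff[of k] assms greedy_subset_set[of "take k \<pi>"] by auto
  finally show ?thesis .
qed

text \<open>A matched edge before \<open>x\<close> in conflict with \<open>\<pi> ! k\<close> would
  precede \<open>x\<close> in the filtered list and would have stopped the loop. So
  \<open>\<pi> ! k\<close> is still free when \<open>x\<close> is queried.\<close>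

lemma called_children:
  assumes "k < m"
  shows "set (called val (lower_conflicts \<pi> (\<pi> ! k))) \<subseteq> children \<pi> (\<pi> ! k)"
proof
  fix x assume "x \<in> set (called val (lower_conflicts \<pi> (\<pi> ! k)))"
  then obtain ys zs where y: "filter (conflicting (\<pi> ! k)) (take k \<pi>) = ys @ x # zs" "\<forall>y\<in>set ys. \<not> val y"
    using called_split lower_conflicts_nth[OF assms] by metis
  then obtain us vs where u: "take k \<pi> = us @ vs" "filter (conflicting (\<pi> ! k)) us = ys"
    "filter (conflicting (\<pi> ! k)) vs = x # zs"
    using filter_eq_appendD[OF y(1)] by blast
  then obtain vs1 vs2 where v: "vs = vs1 @ x # vs2" "\<forall>v\<in>set vs1. \<not> conflicting (\<pi> ! k) v"
    "conflicting (\<pi> ! k) x"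
    by (auto simp: filter_eq_Cons_iff)
  let ?j = "length (us @ vs1)"
  have t: "take k \<pi> = (us @ vs1) @ x # vs2" using u v by simp
  have "length (take k \<pi>) = k" using assms length_perm by simp
  then have j: "?j < k" unfolding t by simp
  have "take ?j (take k \<pi>) = us @ vs1" unfolding t by simp
  then have tj: "take ?j \<pi> = us @ vs1" using j by (simp add: min_absorb1)
  have "take k \<pi> ! ?j = x" unfolding t by (simp only: nth_append_length)
  then have xj: "\<pi> ! ?j = x" using j by simp
  have "free (take ?j \<pi>) (\<pi> ! k)"
    unfolding free_def
  proof (intro ballI notI)
    fix w assume w: "w \<in> greedy (take ?j \<pi>)" "conflicting (\<pi> ! k) w"
    then have "w \<in> set us \<union> set vs1" using greedy_subset_set[of "take ?j \<pi>"] tj by auto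
    then have "w \<in> set ys" using u(2) v(2) w(2) by auto
    moreover have "val w" using w(1) greedy_mono[of "take ?j \<pi>" "drop ?j \<pi>"] by auto
    ultimately show False using y(2) by blast
  qed
  then show "x \<in> children \<pi> (\<pi> ! k)"
    using j xj v(3) assms length_perm unfolding children_def child_def
    by (intro CollectI exI[of _ ?j] exI[of _ k]) simp
qed

text \<open>Chains the progress of the single calls; only \<open>called val xs\<close> is charged,
  because the loop stops at the first true answer.\<close>

lemma run_list_progress:
  assumes "\<And>x s. x \<in> set xs \<Longrightarrow> correct (fst s) \<Longrightarrow> fst (g x s) = val x \<and> progress (S x) 1 s (snd (g x s))"
    and "correct (fst s)"
  shows "fst (run_list g xs s) = (\<forall>x\<in>set xs. \<not> val x) \<and>
    progress (\<Union>x\<in>set (called val xs). S x) (length (called val xs)) s (snd (run_list g xs s))"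
  using assms
proof (induction xs arbitrary: s)
  case Nil
  then show ?case by (simp add: progress_def)
next
  case (Cons x xs)
  obtain b s' where g: "g x s = (b, s')" by (metis prod.exhaust)
  have b: "b = val x" "progress (S x) 1 s s'" using Cons.prems(1)[of x s] Cons.prems(2) g by auto
  show ?case
  proof (cases b)
    case True
    then show ?thesis using g b by simp
  next
    case False
    have "correct (fst s')" using b(2) by (simp add: progress_def)
    then have IH: "fst (run_list g xs s') = (\<forall>x\<in>set xs. \<not> val x)"
      "progress (\<Union>x\<in>set (called val xs). S x) (length (called val xs)) s' (snd (run_list g xs s'))"
      using Cons.IH Cons.prems(1) by auto
    show ?thesis using progress_trans[OF b(2) IH(2)] IH(1) False g b(1) by simp
  qed
qed

text \<open>Induction on the fuel. Recursive calls go to lower positions, so \<open>k < f\<close>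
  keeps the default answer at fuel 0 out of reach. The weight of a new key covers its recursive
  calls, so only the call itself is charged.\<close>

lemma EO_progress:
  assumes "k < f" "k < m" "u \<in> endpoints (\<pi> ! k)" "correct (fst s)"
  shows "fst (EO f sel \<pi> (\<pi> ! k) u s) = val (\<pi> ! k) \<and>
    progress (keys (\<pi> ! k)) 1 s (snd (EO f sel \<pi> (\<pi> ! k) u s))"
  using assms
proof (induction f arbitrary: k u s)
  case (Suc f)
  obtain memo cnt where s: "s = (memo, cnt)" by (metis prod.exhaust)
  let ?e = "\<pi> ! k"
  have eF: "?e \<in> F" using perms_nth[OF perm] Suc.prems(2) .
  have cor: "correct memo" using Suc.prems(4) s by simp
  show ?case
  proof (cases "memo (?e, u)")
    case (Some b)
    then have "b = val ?e" using cor unfolding correct_def by blast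
    then show ?thesis using Some s cor by (simp add: progress_def)
  next
    case None
    let ?L = "lower_conflicts \<pi> ?e"
    let ?C = "called val ?L"
    have call: "fst (EO f sel \<pi> x (sel ?e x) t) = val x \<and> progress (keys x) 1 t (snd (EO f sel \<pi> x (sel ?e x) t))"
      if x: "x \<in> set ?L" and t: "correct (fst t)" for x t
    proof -
      have xx: "x \<in> set (take k \<pi>)" "conflicting ?e x"
        using x lower_conflicts_nth[OF Suc.prems(2)] by auto
      then obtain j where j: "j < k" "x = \<pi> ! j" by (auto simp: in_set_conv_nth)
      have "x \<in> F" using xx(1) set_perm in_set_takeD by fast
      then have "sel ?e x \<in> endpoints x" using sel eF xx(2) unfolding valid_sel_def by blast
      then show ?thesis using Suc.IH[of j "sel ?e x" t] j Suc.prems t by simp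
    qed
    obtain b m2 c2 where r: "run_list (\<lambda>x. EO f sel \<pi> x (sel ?e x)) ?L (memo, Suc cnt) = (b, (m2, c2))"
      by (metis prod.exhaust)
    have R: "b = (\<forall>x\<in>set ?L. \<not> val x)" "progress (\<Union>x\<in>set ?C. keys x) (length ?C) (memo, Suc cnt) (m2, c2)"
      using run_list_progress[of ?L "\<lambda>x. EO f sel \<pi> x (sel ?e x)" keys "(memo, Suc cnt)"] call cor r by auto
    have b: "b = val ?e" using R(1) val_nth_iff Suc.prems(2) by blast
    have C: "set ?C \<subseteq> children \<pi> ?e" by (rule called_children[OF Suc.prems(2)])
    have "distinct ?L" unfolding lower_conflicts_nth[OF Suc.prems(2)] using distinct_perm by simp
    then have len: "length ?C \<le> card (children \<pi> ?e)"
      using card_mono[OF finite_children C] distinct_card[OF distinct_called] by metis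
    \<comment> \<open>Storing the key raises the weight only if the key is absent. The recursive
      calls store keys of lower-ranked edges only.\<close>
    have new: "(?e, u) \<notin> dom m2"
    proof
      assume "(?e, u) \<in> dom m2"
      then obtain x where x: "x \<in> set ?C" "?e \<in> reachable x"
        using R(2) None unfolding progress_def keys_def by auto
      then have "x \<in> set (take k \<pi>)"
        using set_called[of val ?L] lower_conflicts_nth[OF Suc.prems(2)] by auto
      then obtain j where j: "j < k" "x = \<pi> ! j" by (auto simp: in_set_conv_nth)
      then obtain i where "i \<le> j" "\<pi> ! i = ?e" using reachable_index[of ?e j] x(2) Suc.prems(2) by auto
      then show False
        using nth_eq_iff_index_eq[of \<pi> i k] distinct_perm length_perm Suc.prems(2) j by simp
    qed
    have fin: "finite (dom m2)" using R(2) by (simp add: progress_def correct_def)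
    have w: "weight (m2((?e, u) \<mapsto> b)) = card (children \<pi> ?e) + weight m2"
      using new fin by (simp add: weight_def)
    have sub: "(\<Union>x\<in>set ?C. keys x) \<subseteq> keys ?e"
      using C unfolding keys_def reachable_def children_def by (auto intro: converse_rtranclp_into_rtranclp)
    have self: "(?e, u) \<in> keys ?e" using Suc.prems(3) by (simp add: keys_def reachable_def)
    have "correct (m2((?e, u) \<mapsto> b))"
      using R(2) b unfolding progress_def correct_def by auto
    moreover have "dom m2 \<subseteq> dom memo \<union> keys ?e" "dom memo \<subseteq> dom m2"
      "c2 + weight memo \<le> Suc cnt + length ?C + weight m2"
      using R(2)[unfolded progress_def fst_conv snd_conv] sub by blast+
    ultimately have "progress (keys ?e) 1 s (m2((?e, u) \<mapsto> b), c2)"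
      using w len self s unfolding progress_def by auto
    then show ?thesis using None s r b by simp
  qed
qed simp

lemma other_end_in_endpoints:
  assumes "x \<in> F" "u \<in> endpoints x"
  shows "other_end u x \<in> endpoints x"
proof -
  have "\<exists>!w. w \<in> endpoints x \<and> w \<noteq> u"
    using card_endpoints[OF assms(1)] assms(2) by (auto simp: card_2_iff)
  from theI'[OF this] show ?thesis by (simp add: other_end_def)
qed

section \<open>From the vertex oracle to triples\<close>

definition incident :: "nat \<Rightarrow> pedge set" where
  "incident u = {x\<in>F. u \<in> endpoints x}"

lemma VO_progress:
  "progress (\<Union>x\<in>incident u. keys x) (card (incident u)) (\<lambda>_. None, 0) (snd (VO sel \<pi> u))"
proof -
  let ?step = "\<lambda>x (d, s). case EO (Suc (length \<pi>)) sel \<pi> x (other_end u x) s of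
     (b, s') \<Rightarrow> (if b then Suc d else d, s')"
  have fold: "progress (\<Union>x\<in>set xs. keys x) (length xs) (snd ds) (snd (fold ?step xs ds))"
    if "set xs \<subseteq> incident u" "correct (fst (snd ds))" for xs and ds :: "nat \<times> ostate"
    using that
  proof (induction xs arbitrary: ds)
    case Nil
    then show ?case by (simp add: progress_def)
  next
    case (Cons x xs)
    obtain d s where ds: "ds = (d, s)" by (metis prod.exhaust)
    have x: "x \<in> F" "u \<in> endpoints x" using Cons.prems(1) by (auto simp: incident_def)
    then obtain k where k: "k < m" "x = \<pi> ! k"
      using set_perm length_perm by (metis in_set_conv_nth)
    have 1: "progress (keys x) 1 s (snd (EO (Suc (length \<pi>)) sel \<pi> x (other_end u x) s))"
      using EO_progress[of k "Suc (length \<pi>)" "other_end u x" s] k other_end_in_endpoints[OF x]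
        length_perm Cons.prems(2) ds by simp
    have st: "snd (?step x ds) = snd (EO (Suc (length \<pi>)) sel \<pi> x (other_end u x) s)"
      by (simp add: ds split: prod.split)
    have "correct (fst (snd (?step x ds)))" unfolding st using 1 by (simp add: progress_def)
    then have "progress (\<Union>x\<in>set xs. keys x) (length xs) (snd (?step x ds)) (snd (fold ?step xs (?step x ds)))"
      using Cons.IH[of "?step x ds"] Cons.prems(1) by simp
    from progress_trans[OF 1 this[unfolded st]] show ?case
      by (simp add: ds)
  qed
  let ?L = "filter (\<lambda>x. u \<in> endpoints x) \<pi>"
  have L: "set ?L = incident u" using set_perm by (auto simp: incident_def)
  moreover have "length ?L = card (incident u)"
    using distinct_perm L distinct_card by (metis distinct_filter)
  moreover have "correct (\<lambda>_. None)" by (simp add: correct_def)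
  ultimately show ?thesis
    using fold[of ?L "(0, (\<lambda>_. None, 0))"] by (simp add: VO_def)
qed

definition calls :: "pedge \<Rightarrow> nat" where
  "calls e = (\<Sum>x\<in>reachable e. card (children \<pi> x))"

lemma finite_reachable: "e \<in> F \<Longrightarrow> finite (reachable e)"
  using reachable_subset finite_F finite_subset by blast

text \<open>The table starts empty, so the calls are at most the top-level calls plus the final
  weight. The 2 stems from the two possible keys of an edge; edges reachable from several incident
  edges are simply counted repeatedly.\<close>

lemma T_le: "T sel u \<pi> \<le> card (incident u) + 2 * (\<Sum>e\<in>incident u. calls e)"
proof -
  let ?s = "snd (VO sel \<pi> u)"
  let ?U = "\<Union>e\<in>incident u. reachable e"
  have inc: "incident u \<subseteq> F" "finite (incident u)" using finite_F by (auto simp: incident_def)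
  have U: "?U \<subseteq> F" using inc reachable_subset by blast
  have finU: "finite ?U" using U finite_F finite_subset by blast
  have fine: "finite (endpoints x)" if "x \<in> F" for x
    using card_endpoints[OF that] by (metis card.infinite zero_neq_numeral)
  have "weight (fst ?s) \<le> (\<Sum>k\<in>(SIGMA x:?U. endpoints x). card (children \<pi> (fst k)))"
    unfolding weight_def
  proof (rule sum_mono2)
    show "finite (SIGMA x:?U. endpoints x)" using finU fine U by blast
    show "dom (fst ?s) \<subseteq> (SIGMA x:?U. endpoints x)"
      using VO_progress[of u] unfolding progress_def keys_def by auto
  qed simp
  also have "\<dots> = (\<Sum>x\<in>?U. \<Sum>w\<in>endpoints x. card (children \<pi> x))"
    using finU fine U by (subst sum.Sigma) (auto intro!: sum.cong)
  also have "\<dots> = (\<Sum>x\<in>?U. 2 * card (children \<pi> x))"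
    using U card_endpoints by (intro sum.cong) auto
  also have "\<dots> = 2 * (\<Sum>x\<in>?U. card (children \<pi> x))" by (simp add: sum_distrib_left)
  also have "\<dots> \<le> 2 * (\<Sum>e\<in>incident u. calls e)"
    unfolding calls_def using inc finite_reachable
    by (intro mult_left_mono sum_UNION_le) auto
  finally have "weight (fst ?s) \<le> 2 * (\<Sum>e\<in>incident u. calls e)" .
  moreover have "snd ?s \<le> card (incident u) + weight (fst ?s)"
    using VO_progress[of u] unfolding progress_def by (simp add: weight_def)
  ultimately show ?thesis unfolding T_def by linarith
qed

text \<open>Double counting; an inequality because \<open>V\<close> may miss some endpoints.\<close>

lemma sum_incident_le:
  fixes h :: "pedge \<Rightarrow> nat"
  assumes "finite V"
  shows "(\<Sum>v\<in>V. \<Sum>e\<in>incident v. h e) \<le> 2 * (\<Sum>e\<in>F. h e)"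
proof -
  have "(\<Sum>v\<in>V. \<Sum>e\<in>incident v. h e) = (\<Sum>e\<in>F. \<Sum>v | v \<in> V \<and> v \<in> endpoints e. h e)"
    unfolding incident_def using assms finite_F by (rule sum.swap_restrict)
  also have "\<dots> \<le> (\<Sum>e\<in>F. 2 * h e)"
  proof (rule sum_mono)
    fix e assume e: "e \<in> F"
    then have "finite (endpoints e)" using card_endpoints by (metis card.infinite zero_neq_numeral)
    then have "card {v\<in>V. v \<in> endpoints e} \<le> 2"
      using card_mono[of "endpoints e" "{v\<in>V. v \<in> endpoints e}"] card_endpoints[OF e] by auto
    then show "(\<Sum>v | v \<in> V \<and> v \<in> endpoints e. h e) \<le> 2 * h e" by simp
  qed
  finally show ?thesis by (simp add: sum_distrib_left)
qed

lemma card_triples: "card (triples \<pi>) = (\<Sum>e\<in>F. calls e)"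
proof -
  have "triples \<pi> = (SIGMA e:F. SIGMA x:reachable e. children \<pi> x)"
    by (auto simp: triples_def reachable_def)
  moreover have "card (SIGMA x:reachable e. children \<pi> x) = calls e" if "e \<in> F" for e
    unfolding calls_def using finite_reachable[OF that] by (intro card_SigmaI) auto
  moreover have "card (SIGMA e:F. SIGMA x:reachable e. children \<pi> x) =
      (\<Sum>e\<in>F. card (SIGMA x:reachable e. children \<pi> x))"
    using finite_F finite_reachable by (intro card_SigmaI) auto
  ultimately show ?thesis by simp
qed

lemma sum_T_le:
  assumes "finite V"
  shows "(\<Sum>v\<in>V. T sel v \<pi>) \<le> 2 * m + 4 * card (triples \<pi>)"
proof -
  have "(\<Sum>v\<in>V. T sel v \<pi>) \<le> (\<Sum>v\<in>V. (\<Sum>e\<in>incident v. 1) + 2 * (\<Sum>e\<in>incident v. calls e))"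
    using T_le by (intro sum_mono) simp
  also have "\<dots> = (\<Sum>v\<in>V. \<Sum>e\<in>incident v. 1) + 2 * (\<Sum>v\<in>V. \<Sum>e\<in>incident v. calls e)"
    by (simp only: sum.distrib sum_distrib_left)
  also have "\<dots> \<le> 2 * (\<Sum>e\<in>F. 1) + 2 * (2 * (\<Sum>e\<in>F. calls e))"
    using assms by (intro add_mono mult_left_mono sum_incident_le) auto
  finally show ?thesis by (simp add: card_triples)
qed

end

subsection \<open>The multigraph of a simple graph\<close>

lemma Gprime_ports:
  assumes "simple_graph V E" "e \<in> Gprime K E"
  shows "card (ports e) = 2" "card (endpoints e) = 2"
proof -
  have "u \<noteq> v" if "{u, v} \<in> E" for u v
    using that assms(1) unfolding simple_graph_def by fastforce
  then show "card (ports e) = 2" "card (endpoints e) = 2"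
    using assms(2) by (auto simp: Gprime_def ports_def endpoints_def)
qed

lemma simple_graph_finite:
  assumes "simple_graph V E"
  shows "finite E" "card E \<le> (card V)\<^sup>2"
proof -
  have V: "finite V" using assms by (simp add: simple_graph_def)
  have sub: "E \<subseteq> (\<lambda>(u, v). {u, v}) ` (V \<times> V)"
  proof
    fix e assume "e \<in> E"
    then have "e \<subseteq> V" "card e = 2" using assms by (auto simp: simple_graph_def)
    then show "e \<in> (\<lambda>(u, v). {u, v}) ` (V \<times> V)" by (auto simp: card_2_iff)
  qed
  have fin: "finite ((\<lambda>(u, v). {u, v}) ` (V \<times> V))" using V by simp
  show "finite E" by (rule finite_subset[OF sub fin])
  have "card E \<le> card ((\<lambda>(u, v). {u, v}) ` (V \<times> V))" by (rule card_mono[OF fin sub])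
  also have "\<dots> \<le> card (V \<times> V)" using V by (intro card_image_le) simp
  finally show "card E \<le> (card V)\<^sup>2" by (simp add: card_cartesian_product power2_eq_square)
qed

text \<open>Per edge there are two mixed copies, one for each orientation, and \<open>K\<close>
  copies on the ports of index 0.\<close>

lemma card_Gprime:
  assumes "simple_graph V E"
  shows "finite (Gprime K E)" "card (Gprime K E) \<le> (K + 2) * card E"
proof -
  let ?A = "\<lambda>d. {({(u, 0), (v, 1)}, 0) | u v. {u, v} = d} :: pedge set"
  let ?B = "\<lambda>d. (\<lambda>c. ((\<lambda>w. (w, 0)) ` d, c)) ` {..<K} :: pedge set"
  have fin: "finite E" by (rule simple_graph_finite[OF assms])
  have AB: "finite (?A d \<union> ?B d) \<and> card (?A d \<union> ?B d) \<le> K + 2" if d: "d \<in> E" for d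
  proof -
    have "card d = 2" using assms d by (simp add: simple_graph_def)
    then obtain a b where ab: "d = {a, b}" by (auto simp: card_2_iff)
    let ?S = "{({(a, 0), (b, 1)}, 0), ({(b, 0), (a, 1)}, 0)} :: pedge set"
    have sub: "?A d \<subseteq> ?S" unfolding ab by (auto simp: doubleton_eq_iff)
    have "card (?A d) \<le> card ?S" by (rule card_mono[OF _ sub]) simp
    also have "card ?S \<le> 2" by (simp add: card_insert_if)
    finally have "card (?A d) \<le> 2" .
    moreover have "card (?B d) \<le> card {..<K}" by (rule card_image_le) simp
    ultimately have "card (?A d \<union> ?B d) \<le> K + 2" using card_Un_le[of "?A d" "?B d"] by simp
    moreover have "finite (?A d)" using finite_subset[OF sub] by simp
    ultimately show ?thesis by simp
  qed
  have sub: "Gprime K E \<subseteq> (\<Union>d\<in>E. ?A d \<union> ?B d)"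
  proof
    fix e assume "e \<in> Gprime K E"
    then consider u v where "{u, v} \<in> E" "e = ({(u, 0), (v, 1)}, 0)"
      | u v c where "{u, v} \<in> E" "c < K" "e = ({(u, 0), (v, 0)}, c)"
      unfolding Gprime_def by blast
    then show "e \<in> (\<Union>d\<in>E. ?A d \<union> ?B d)"
    proof cases
      case 1
      then have "e \<in> ?A {u, v}" by blast
      then show ?thesis using 1 by blast
    next
      case 2
      then have "e \<in> ?B {u, v}" by auto
      then show ?thesis using 2 by blast
    qed
  qed
  have finU: "finite (\<Union>d\<in>E. ?A d \<union> ?B d)" using fin AB by (intro finite_UN_I) blast+
  show "finite (Gprime K E)" by (rule finite_subset[OF sub finU])
  have "card (Gprime K E) \<le> card (\<Union>d\<in>E. ?A d \<union> ?B d)" by (rule card_mono[OF finU sub])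
  also have "\<dots> \<le> (\<Sum>d\<in>E. card (?A d \<union> ?B d))" by (rule card_UN_le[OF fin])
  also have "\<dots> \<le> (\<Sum>d\<in>E. K + 2)" using AB by (intro sum_mono) blast
  finally show "card (Gprime K E) \<le> (K + 2) * card E" by (simp add: algebra_simps)
qed

text \<open>The 8 in the exponent is chosen to match \<open>M ^ 4 \<le> c ^ 4 * n ^ 8\<close>, which
  reduces the \<open>M ^ 5\<close> term to order \<open>M\<close>. From \<open>n \<ge> 3\<close>
  follows \<open>ln n \<ge> 1\<close>, so all terms fit below \<open>M * (ln n)\<^sup>2\<close>. The
  coefficients are \<open>2 + 4 * 6\<close>, \<open>4 * 4 * 8\<close> and
  \<open>4 * 2\<close>.\<close>

lemma triple_bound_le:
  fixes n c M :: real
  assumes "n \<ge> 3" "c \<ge> 1" "M \<ge> 1" "M \<le> c * n\<^sup>2"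
  shows "2 * M + 4 * (6 * M + 4 * (8 * ln n) * M * (1 + ln M) + 2 * M ^ 5 * exp (- (8 * ln n)))
     \<le> (26 + 128 * (3 + ln c) + 8 * c ^ 4) * M * (ln n)\<^sup>2"
proof -
  define L where "L = ln n"
  have "exp 1 \<le> n" using exp_le assms(1) by linarith
  then have L: "L \<ge> 1" using assms(1) unfolding L_def by (subst ln_ge_iff) auto
  have "ln M \<le> ln (c * n\<^sup>2)" using assms by (intro ln_mono) auto
  also have "\<dots> = ln c + 2 * L" using assms by (simp add: ln_mult ln_realpow L_def)
  finally have "1 + ln M \<le> 1 + ln c + 2 * L" by simp
  also have "\<dots> \<le> (3 + ln c) * L"
  proof -
    have "(1 + ln c) * 1 \<le> (1 + ln c) * L" using L assms(2) by (intro mult_left_mono) auto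
    then show ?thesis by (simp add: algebra_simps)
  qed
  finally have lnM: "1 + ln M \<le> (3 + ln c) * L" .
  have L2: "1 \<le> L\<^sup>2" using L by (simp add: one_le_power)
  have "exp (- (8 * L)) = 1 / n ^ 8"
    using assms(1) unfolding L_def by (simp add: exp_minus exp_of_nat_mult[of 8 "ln n", simplified] inverse_eq_divide)
  moreover have "M ^ 4 \<le> (c * n\<^sup>2) ^ 4" using assms by (intro power_mono) auto
  ultimately have "M ^ 4 * exp (- (8 * L)) \<le> c ^ 4"
    using assms(1) by (simp add: power_mult_distrib divide_le_eq flip: power_mult)
  then have "M * (M ^ 4 * exp (- (8 * L))) \<le> M * c ^ 4"
    using assms by (intro mult_left_mono) auto
  then have "M ^ 5 * exp (- (8 * L)) \<le> M * c ^ 4"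
    by (simp add: eval_nat_numeral mult.assoc)
  also have "\<dots> \<le> M * c ^ 4 * L\<^sup>2"
    using mult_left_mono[OF L2, of "M * c ^ 4"] assms by simp
  finally have 1: "M ^ 5 * exp (- (8 * L)) \<le> M * c ^ 4 * L\<^sup>2" .
  have "L * M * (1 + ln M) \<le> L * M * ((3 + ln c) * L)"
    using lnM L assms by (intro mult_left_mono) auto
  then have 2: "L * M * (1 + ln M) \<le> (3 + ln c) * M * L\<^sup>2"
    by (simp add: power2_eq_square mult_ac)
  have 3: "M \<le> M * L\<^sup>2" using mult_left_mono[OF L2, of M] assms by simp
  show ?thesis
    unfolding L_def[symmetric] using 1 2 3 by (simp add: algebra_simps)
qed

theorem theorem5p4:
  fixes K :: nat
  assumes "K > 0"
  shows "\<exists>C N. \<forall>V E sel.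
           simple_graph V E \<and> V \<noteq> {} \<and> card V \<ge> N \<and> valid_sel (Gprime K E) sel \<longrightarrow>
           expected_T K V E sel \<le> C * avg_deg V E * (ln (real (card V)))\<^sup>2"
proof -
  define c :: real where "c = real (K + 2)"
  define B where "B = 26 + 128 * (3 + ln c) + 8 * c ^ 4"
  have B: "B \<ge> 0" using c_def by (simp add: B_def)
  \<comment> \<open>The witnesses: \<open>N = 3\<close> comes from \<open>triple_bound_le\<close>,
    and the half in \<open>C = B * c / 2\<close> offsets the 2 in \<open>avg_deg\<close>.\<close>
  have "expected_T K V E sel \<le> (B * c / 2) * avg_deg V E * (ln (real (card V)))\<^sup>2"
    if G: "simple_graph V E" and n: "card V \<ge> 3" and sel: "valid_sel (Gprime K E) sel" for V E sel
  proof -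
    let ?F = "Gprime K E" and ?n = "real (card V)"
    let ?P = "permutations_of_set ?F" and ?M = "real (card (Gprime K E))"
    interpret port_multigraph ?F
      using card_Gprime(1)[OF G] Gprime_ports(1)[OF G] by unfold_locales
    have finV: "finite V" using G by (simp add: simple_graph_def)
    have "?M \<le> real ((K + 2) * card E)"
      using card_Gprime(2)[OF G, of K] by (simp only: of_nat_le_iff)
    then have M: "?M \<le> c * card E" by (simp add: c_def algebra_simps)
    have "c * real (card E) \<le> c * real ((card V)\<^sup>2)"
      using simple_graph_finite(2)[OF G] by (intro mult_left_mono) (simp_all only: of_nat_le_iff, simp add: c_def)
    then have Mn: "?M \<le> c * ?n\<^sup>2" using M by simp
    have T: "(\<Sum>v\<in>V. real (T sel v \<pi>)) \<le> 2 * ?M + 4 * real (card (triples \<pi>))" if "\<pi> \<in> ?P" for \<pi>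
    proof -
      interpret edge_oracle ?F sel \<pi>
        using that sel Gprime_ports(2)[OF G] by unfold_locales
      have "real (\<Sum>v\<in>V. T sel v \<pi>) \<le> real (2 * card ?F + 4 * card (triples \<pi>))"
        using sum_T_le[OF finV] by (simp only: of_nat_le_iff)
      then show ?thesis by simp
    qed
    have "(\<Sum>v\<in>V. \<Sum>\<pi>\<in>?P. real (T sel v \<pi>)) = (\<Sum>\<pi>\<in>?P. \<Sum>v\<in>V. real (T sel v \<pi>))"
      by (rule sum.swap)
    also have "\<dots> \<le> (\<Sum>\<pi>\<in>?P. 2 * ?M + 4 * real (card (triples \<pi>)))"
      using T by (intro sum_mono)
    also have "\<dots> = fact (card ?F) * (2 * ?M) + 4 * (\<Sum>\<pi>\<in>?P. real (card (triples \<pi>)))"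
      using card_perms by (simp add: sum.distrib sum_distrib_left)
    \<comment> \<open>Without edges both sides vanish; otherwise \<open>?M \<ge> 1\<close>, as the
      bounds with \<open>ln ?M\<close> require.\<close>
    also have "\<dots> \<le> fact (card ?F) * (B * ?M * (ln ?n)\<^sup>2)"
    proof (cases "?F = {}")
      case True
      then have "triples \<pi> = {}" for \<pi> unfolding triples_def by simp
      then show ?thesis using True by simp
    next
      case False
      then have m: "card ?F > 0" using finite_F by (simp add: card_gt_0_iff)
      have "fact (card ?F) * (2 * ?M) + 4 * (\<Sum>\<pi>\<in>?P. real (card (triples \<pi>)))
          \<le> fact (card ?F) * (2 * ?M + 4 * (6 * ?M + 4 * (8 * ln ?n) * ?M * (1 + ln ?M) +
              2 * ?M ^ 5 * exp (- (8 * ln ?n))))"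
        using sum_card_triples_le[of "8 * ln ?n"] m n by (simp add: algebra_simps)
      also have "\<dots> \<le> fact (card ?F) * (B * ?M * (ln ?n)\<^sup>2)"
        unfolding B_def using triple_bound_le[of ?n c ?M] n m Mn
        by (intro mult_left_mono) (auto simp: c_def)
      finally show ?thesis .
    qed
    finally have S: "(\<Sum>v\<in>V. \<Sum>\<pi>\<in>?P. real (T sel v \<pi>)) \<le> fact (card ?F) * (B * ?M * (ln ?n)\<^sup>2)" .
    have "expected_T K V E sel \<le> fact (card ?F) * (B * ?M * (ln ?n)\<^sup>2) / (?n * real (card ?P))"
      unfolding expected_T_def using S by (intro divide_right_mono) auto
    also have "\<dots> = B * ?M * (ln ?n)\<^sup>2 / ?n" using card_perms by simp
    also have "\<dots> \<le> B * (c * card E) * (ln ?n)\<^sup>2 / ?n"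
      using M B by (intro divide_right_mono mult_right_mono mult_left_mono) auto
    also have "\<dots> = (B * c / 2) * avg_deg V E * (ln ?n)\<^sup>2"
      by (simp add: avg_deg_def)
    finally show ?thesis .
  qed
  then show ?thesis by blast
qed

end
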